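(* Let $\mathcal{P}=(\mathcal{P},m,\Delta,\delta)$ be a connected double twisted bialgebra. There exists a unique morphism $\phi$ of double bialgebras from $\mathcal{P}$ to $\mathcal{C}omp$. Moreover, the following maps are bijections, inverse one from the other: \begin{align*} \varsigma&:\left\{\begin{array}{rcl} \mathrm{Char}(\mathcal{P})&\longrightarrow&\mathrm{Mor}_B(\mathcal{P},\mathcal{C}omp)\\ f&\longrightarrow&\phi\leftarrow f, \end{array}\right.\\ \varsigma'&:\left\{\begin{array}{rcl} \mathrm{Mor}_B(\mathcal{P},\mathcal{C}omp)&\longrightarrow&\mathrm{Char}(\mathcal{P})\\ \phi&\longrightarrow&\varepsilon'\circ \phi. \end{array}\right. \end{align*}
   Context: A double twisted bialgebra is a twisted bialgebra $(\mathcal{P},m,\Delta)$ (bialgebra for the Cauchy tensor product of species) with, for each finite set $A$, a coassociative counital coproduct $\delta_A:\mathcal{P}[A]\to\mathcal{P}[A]\otimes\mathcal{P}[A]$ (counit $\varepsilon'$), natural in $A$, multiplicative, with $(\Delta_{A,B}\otimes Id)\circ\delta_{A\sqcup B}=m_{1,3,24}\circ(\delta_A\otimes\delta_B)\circ\Delta_{A,B}$ where $m_{1,3,24}(x\otimes y\otimes z\otimes t)=x\otimes z\otimes m_{A,B}(y\otimes t)$, and compatible counit $\varepsilon$. Connected means $\mathcal{P}[\emptyset]$ is one-dimensional. $\mathrm{Char}(\mathcal{P})$ is the set of twisted algebra morphisms $\mathcal{P}\to\mathcal{C}om$ ($\mathcal{C}om[A]=\mathbb{K}$ with multiplication of scalars),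 $\mathrm{Mor}_B(\mathcal{P},\mathcal{C}omp)$ is the set of twisted bialgebra morphisms $\mathcal{P}\to\mathcal{C}omp$, and $\phi\leftarrow f=(\phi\otimes f)\circ\delta$. $\mathcal{C}omp[A]$ has basis the set compositions $(A_1,\ldots,A_k)$ of $A$, with quasi-shuffle product $\uplus$: $(A_1,\ldots,A_k)\uplus(A_{k+1},\ldots,A_{k+l})=\sum_{\sigma\in QSh(k,l)}\big(\bigcup_{\sigma(i)=1}A_i,\ldots,\bigcup_{\sigma(i)=\max\sigma}A_i\big)$ ($QSh(k,l)$: surjections $\{1,\ldots,k+l\}\to\{1,\ldots,\max\sigma\}$ nondecreasing on $\{1,\ldots,k\}$ and $\{k+1,\ldots,k+l\}$), deconcatenation coproduct $\Delta$, and second coproduct $\delta_A(A_1,\ldots,A_k)=\sum_{1\le i_1<\cdots<i_p<k}(A_1\sqcup\cdots\sqcup A_{i_1},\ldots,A_{i_p+1}\sqcup\cdots\sqcup A_k)\otimes(A_1,\ldots,A_{i_1})\uplus\cdots\uplus(A_{i_p+1},\ldots,A_k)$, whose counit is $\varepsilon'(A_1,\ldots,A_k)=\delta_{k,1}$.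
   Formalization: Quasi-shuffles are taken strictly increasing on each block (with "nondecreasing", the empty composition is not a unit for the product), and ε' of the empty composition is 1, not δ_{0,1}=0, with δ(())=()⊗(), as counitality on the empty set requires. *)

theory Defs
  imports Main "HOL-Library.Function_Algebras"
begin

text \<open>A vector of a space with basis S (a subset of a type 'b) over a field 'k is a
finitely supported function 'b => 'k supported in S. Linear maps are determined by
their values on basis elements and extended linearly (lext / lin). The tensor product
of spaces with bases S and T is the space with basis S x T.\<close>

definition supp :: "('b \<Rightarrow> 'k::zero) \<Rightarrow> 'b set" where
  "supp v = {b. v b \<noteq> 0}"

definition isvec :: "'b set \<Rightarrow> ('b \<Rightarrow> 'k::zero) \<Rightarrow> bool" where
  "isvec S v \<longleftrightarrow> finite (supp v) \<and> supp v \<subseteq> S"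

definition ind :: "'b \<Rightarrow> 'b \<Rightarrow> 'k::{zero,one}" where
  "ind b = (\<lambda>c. if c = b then 1 else 0)"

definition lin :: "('b \<Rightarrow> 'k::comm_semiring_1) \<Rightarrow> ('b \<Rightarrow> 'k) \<Rightarrow> 'k" where
  "lin f v = (\<Sum>b\<in>supp v. v b * f b)"

definition lext :: "('b \<Rightarrow> 'c \<Rightarrow> 'k::comm_semiring_1) \<Rightarrow> ('b \<Rightarrow> 'k) \<Rightarrow> 'c \<Rightarrow> 'k" where
  "lext f v = (\<lambda>c. lin (\<lambda>b. f b c) v)"

definition tens :: "('b \<Rightarrow> 'k::times) \<Rightarrow> ('c \<Rightarrow> 'k) \<Rightarrow> 'b \<times> 'c \<Rightarrow> 'k" where
  "tens x y = (\<lambda>(b, c). x b * y c)"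

definition tmap :: "('a \<Rightarrow> 'c \<Rightarrow> 'k::times) \<Rightarrow> ('b \<Rightarrow> 'd \<Rightarrow> 'k) \<Rightarrow> 'a \<times> 'b \<Rightarrow> 'c \<times> 'd \<Rightarrow> 'k" where
  "tmap f g = (\<lambda>(a, b). tens (f a) (g b))"

text \<open>Finite sets are the finite subsets of nat; a bijection A -> B of finite sets is
represented by a map sigma injective on A, with B = sigma ` A.
sp_bas A: a basis of P[A];  sp_act sigma A: P[sigma] on basis elements;
sp_mul A B: m_{A,B};  sp_unit: unit 1 in P[{}];  sp_Delta A B: Delta_{A,B};
sp_eps: counit of Delta (a functional on P[{}]);  sp_delta A: delta_A;
sp_eps2 A: counit epsilon' of delta_A.\<close>

record ('b, 'k) twsp =
  sp_bas :: "nat set \<Rightarrow> 'b set"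
  sp_act :: "(nat \<Rightarrow> nat) \<Rightarrow> nat set \<Rightarrow> 'b \<Rightarrow> 'b \<Rightarrow> 'k"
  sp_mul :: "nat set \<Rightarrow> nat set \<Rightarrow> 'b \<Rightarrow> 'b \<Rightarrow> 'b \<Rightarrow> 'k"
  sp_unit :: "'b \<Rightarrow> 'k"
  sp_Delta :: "nat set \<Rightarrow> nat set \<Rightarrow> 'b \<Rightarrow> 'b \<times> 'b \<Rightarrow> 'k"
  sp_eps :: "'b \<Rightarrow> 'k"
  sp_delta :: "nat set \<Rightarrow> 'b \<Rightarrow> 'b \<times> 'b \<Rightarrow> 'k"
  sp_eps2 :: "nat set \<Rightarrow> 'b \<Rightarrow> 'k"

definition actv :: "('b, 'k::comm_semiring_1, 'z) twsp_scheme \<Rightarrow> (nat \<Rightarrow> nat) \<Rightarrow> nat set \<Rightarrow> ('b \<Rightarrow> 'k) \<Rightarrow> 'b \<Rightarrow> 'k" where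
  "actv P \<sigma> A v = lext (sp_act P \<sigma> A) v"

definition mulv :: "('b, 'k::comm_semiring_1, 'z) twsp_scheme \<Rightarrow> nat set \<Rightarrow> nat set \<Rightarrow> ('b \<times> 'b \<Rightarrow> 'k) \<Rightarrow> 'b \<Rightarrow> 'k" where
  "mulv P A B t = lext (\<lambda>(b, c). sp_mul P A B b c) t"

definition Deltav :: "('b, 'k::comm_semiring_1, 'z) twsp_scheme \<Rightarrow> nat set \<Rightarrow> nat set \<Rightarrow> ('b \<Rightarrow> 'k) \<Rightarrow> 'b \<times> 'b \<Rightarrow> 'k" where
  "Deltav P A B v = lext (sp_Delta P A B) v"

definition deltav :: "('b, 'k::comm_semiring_1, 'z) twsp_scheme \<Rightarrow> nat set \<Rightarrow> ('b \<Rightarrow> 'k) \<Rightarrow> 'b \<times> 'b \<Rightarrow> 'k" where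
  "deltav P A v = lext (sp_delta P A) v"

definition species :: "('b, 'k::comm_semiring_1, 'z) twsp_scheme \<Rightarrow> bool" where
  "species P \<longleftrightarrow>
    (\<forall>A \<sigma>. finite A \<and> inj_on \<sigma> A \<longrightarrow>
        (\<forall>b\<in>sp_bas P A. isvec (sp_bas P (\<sigma> ` A)) (sp_act P \<sigma> A b))) \<and>
    (\<forall>A \<sigma> \<tau>. finite A \<and> (\<forall>x\<in>A. \<sigma> x = \<tau> x) \<longrightarrow>
        (\<forall>b\<in>sp_bas P A. sp_act P \<sigma> A b = sp_act P \<tau> A b)) \<and>
    (\<forall>A \<sigma>. finite A \<and> (\<forall>x\<in>A. \<sigma> x = x) \<longrightarrow>
        (\<forall>b\<in>sp_bas P A. sp_act P \<sigma> A b = ind b)) \<and>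
    (\<forall>A \<sigma> \<tau>. finite A \<and> inj_on \<sigma> A \<and> inj_on \<tau> (\<sigma> ` A) \<longrightarrow>
        (\<forall>b\<in>sp_bas P A. sp_act P (\<tau> \<circ> \<sigma>) A b = actv P \<tau> (\<sigma> ` A) (sp_act P \<sigma> A b)))"

definition twisted_algebra :: "('b, 'k::comm_semiring_1, 'z) twsp_scheme \<Rightarrow> bool" where
  "twisted_algebra P \<longleftrightarrow>
    (\<forall>A B. finite A \<and> finite B \<and> A \<inter> B = {} \<longrightarrow>
      (\<forall>b\<in>sp_bas P A. \<forall>c\<in>sp_bas P B.
         isvec (sp_bas P (A \<union> B)) (sp_mul P A B b c) \<and>
         (\<forall>\<sigma>. inj_on \<sigma> (A \<union> B) \<longrightarrow>
            actv P \<sigma> (A \<union> B) (sp_mul P A B b c)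
            = mulv P (\<sigma> ` A) (\<sigma> ` B) (tens (sp_act P \<sigma> A b) (sp_act P \<sigma> B c))))) \<and>
    (\<forall>A B C. finite A \<and> finite B \<and> finite C \<and> A \<inter> B = {} \<and> A \<inter> C = {} \<and> B \<inter> C = {} \<longrightarrow>
      (\<forall>b\<in>sp_bas P A. \<forall>c\<in>sp_bas P B. \<forall>d\<in>sp_bas P C.
         mulv P (A \<union> B) C (tens (sp_mul P A B b c) (ind d))
         = mulv P A (B \<union> C) (tens (ind b) (sp_mul P B C c d)))) \<and>
    isvec (sp_bas P {}) (sp_unit P) \<and>
    (\<forall>A. finite A \<longrightarrow> (\<forall>b\<in>sp_bas P A.
         mulv P {} A (tens (sp_unit P) (ind b)) = ind b \<and>
         mulv P A {} (tens (ind b) (sp_unit P)) = ind b))"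

definition twisted_coalgebra :: "('b, 'k::comm_semiring_1, 'z) twsp_scheme \<Rightarrow> bool" where
  "twisted_coalgebra P \<longleftrightarrow>
    (\<forall>A B. finite A \<and> finite B \<and> A \<inter> B = {} \<longrightarrow>
      (\<forall>b\<in>sp_bas P (A \<union> B).
         isvec (sp_bas P A \<times> sp_bas P B) (sp_Delta P A B b) \<and>
         (\<forall>\<sigma>. inj_on \<sigma> (A \<union> B) \<longrightarrow>
            lext (tmap (sp_act P \<sigma> A) (sp_act P \<sigma> B)) (sp_Delta P A B b)
            = Deltav P (\<sigma> ` A) (\<sigma> ` B) (sp_act P \<sigma> (A \<union> B) b)))) \<and>
    (\<forall>A B C. finite A \<and> finite B \<and> finite C \<and> A \<inter> B = {} \<and> A \<inter> C = {} \<and> B \<inter> C = {} \<longrightarrow>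
      (\<forall>b\<in>sp_bas P (A \<union> B \<union> C).
         lext (\<lambda>(x, z). (\<lambda>(p, q, r). sp_Delta P A B x (p, q) * ind z r)) (sp_Delta P (A \<union> B) C b)
         = lext (\<lambda>(x, y). tens (ind x) (sp_Delta P B C y)) (sp_Delta P A (B \<union> C) b))) \<and>
    (\<forall>A. finite A \<longrightarrow> (\<forall>b\<in>sp_bas P A.
         lext (\<lambda>(x, y). (\<lambda>z. sp_eps P x * ind y z)) (sp_Delta P {} A b) = ind b \<and>
         lext (\<lambda>(x, y). (\<lambda>z. ind x z * sp_eps P y)) (sp_Delta P A {} b) = ind b))"

definition twisted_bialgebra :: "('b, 'k::comm_semiring_1, 'z) twsp_scheme \<Rightarrow> bool" where
  "twisted_bialgebra P \<longleftrightarrow>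
    species P \<and> twisted_algebra P \<and> twisted_coalgebra P \<and>
    (\<forall>A B C D. finite A \<and> finite B \<and> A \<inter> B = {} \<and> finite C \<and> finite D \<and> C \<inter> D = {}
        \<and> C \<union> D = A \<union> B \<longrightarrow>
      (\<forall>b\<in>sp_bas P C. \<forall>c\<in>sp_bas P D.
         Deltav P A B (sp_mul P C D b c)
         = lext (\<lambda>((x1, x2), (y1, y2)).
                   tens (sp_mul P (C \<inter> A) (D \<inter> A) x1 y1) (sp_mul P (C \<inter> B) (D \<inter> B) x2 y2))
                (tens (sp_Delta P (C \<inter> A) (C \<inter> B) b) (sp_Delta P (D \<inter> A) (D \<inter> B) c)))) \<and>
    Deltav P {} {} (sp_unit P) = tens (sp_unit P) (sp_unit P) \<and>
    (\<forall>b\<in>sp_bas P {}. \<forall>c\<in>sp_bas P {}. lin (sp_eps P) (sp_mul P {} {} b c) = sp_eps P b * sp_eps P c) \<and>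
    lin (sp_eps P) (sp_unit P) = 1"

definition double_twisted_bialgebra :: "('b, 'k::comm_semiring_1, 'z) twsp_scheme \<Rightarrow> bool" where
  "double_twisted_bialgebra P \<longleftrightarrow>
    twisted_bialgebra P \<and>
    (\<forall>A. finite A \<longrightarrow> (\<forall>b\<in>sp_bas P A.
       isvec (sp_bas P A \<times> sp_bas P A) (sp_delta P A b) \<and>
       \<comment> \<open>naturality\<close>
       (\<forall>\<sigma>. inj_on \<sigma> A \<longrightarrow>
          deltav P (\<sigma> ` A) (sp_act P \<sigma> A b)
          = lext (tmap (sp_act P \<sigma> A) (sp_act P \<sigma> A)) (sp_delta P A b)) \<and>
       \<comment> \<open>coassociativity\<close>
       lext (\<lambda>(x, z). (\<lambda>(p, q, r). sp_delta P A x (p, q) * ind z r)) (sp_delta P A b)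
         = lext (\<lambda>(x, y). tens (ind x) (sp_delta P A y)) (sp_delta P A b) \<and>
       \<comment> \<open>counit\<close>
       lext (\<lambda>(x, y). (\<lambda>z. sp_eps2 P A x * ind y z)) (sp_delta P A b) = ind b \<and>
       lext (\<lambda>(x, y). (\<lambda>z. ind x z * sp_eps2 P A y)) (sp_delta P A b) = ind b)) \<and>
    \<comment> \<open>multiplicativity of delta (m is a coalgebra morphism, unit group-like)\<close>
    (\<forall>A B. finite A \<and> finite B \<and> A \<inter> B = {} \<longrightarrow>
      (\<forall>b\<in>sp_bas P A. \<forall>c\<in>sp_bas P B.
         deltav P (A \<union> B) (sp_mul P A B b c)
         = lext (\<lambda>((x1, x2), (y1, y2)). tens (sp_mul P A B x1 y1) (sp_mul P A B x2 y2))
                (tens (sp_delta P A b) (sp_delta P B c)) \<and>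
         lin (sp_eps2 P (A \<union> B)) (sp_mul P A B b c) = sp_eps2 P A b * sp_eps2 P B c)) \<and>
    deltav P {} (sp_unit P) = tens (sp_unit P) (sp_unit P) \<and>
    lin (sp_eps2 P {}) (sp_unit P) = 1 \<and>
    \<comment> \<open>(Delta_{A,B} (x) Id) o delta_{A u B} = m_{1,3,24} o (delta_A (x) delta_B) o Delta_{A,B}\<close>
    (\<forall>A B. finite A \<and> finite B \<and> A \<inter> B = {} \<longrightarrow>
      (\<forall>b\<in>sp_bas P (A \<union> B).
         lext (\<lambda>(x, y). (\<lambda>(p, q, r). sp_Delta P A B x (p, q) * ind y r)) (sp_delta P (A \<union> B) b)
         = lext (\<lambda>(u, v). lext (\<lambda>((x, y), (z, t)). tens (ind x) (tens (ind z) (sp_mul P A B y t)))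
                                (tens (sp_delta P A u) (sp_delta P B v)))
                (sp_Delta P A B b))) \<and>
    \<comment> \<open>compatible counit: (eps (x) Id) o delta_{} = eta o eps on P[{}]\<close>
    (\<forall>b\<in>sp_bas P {}.
       lext (\<lambda>(x, y). (\<lambda>z. sp_eps P x * ind y z)) (sp_delta P {} b) = (\<lambda>z. sp_eps P b * sp_unit P z))"

definition connected :: "('b, 'k, 'z) twsp_scheme \<Rightarrow> bool" where
  "connected P \<longleftrightarrow> card (sp_bas P {}) = 1"

definition extensional_fam :: "('b, 'k, 'z) twsp_scheme \<Rightarrow> (nat set \<Rightarrow> 'b \<Rightarrow> 'v::zero) \<Rightarrow> bool" where
  "extensional_fam P g \<longleftrightarrow> (\<forall>A b. \<not> (finite A \<and> b \<in> sp_bas P A) \<longrightarrow> g A b = 0)"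

definition tb_morphism :: "('b, 'k::comm_semiring_1, 'z) twsp_scheme \<Rightarrow> ('c, 'k, 'y) twsp_scheme
     \<Rightarrow> (nat set \<Rightarrow> 'b \<Rightarrow> 'c \<Rightarrow> 'k) \<Rightarrow> bool" where
  "tb_morphism P Q \<phi> \<longleftrightarrow>
    extensional_fam P \<phi> \<and>
    (\<forall>A. finite A \<longrightarrow> (\<forall>b\<in>sp_bas P A.
       isvec (sp_bas Q A) (\<phi> A b) \<and>
       (\<forall>\<sigma>. inj_on \<sigma> A \<longrightarrow> lext (\<phi> (\<sigma> ` A)) (sp_act P \<sigma> A b) = actv Q \<sigma> A (\<phi> A b)))) \<and>
    (\<forall>A B. finite A \<and> finite B \<and> A \<inter> B = {} \<longrightarrow>
      (\<forall>b\<in>sp_bas P A. \<forall>c\<in>sp_bas P B.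
         lext (\<phi> (A \<union> B)) (sp_mul P A B b c) = mulv Q A B (tens (\<phi> A b) (\<phi> B c))) \<and>
      (\<forall>b\<in>sp_bas P (A \<union> B).
         Deltav Q A B (\<phi> (A \<union> B) b) = lext (tmap (\<phi> A) (\<phi> B)) (sp_Delta P A B b))) \<and>
    lext (\<phi> {}) (sp_unit P) = sp_unit Q \<and>
    (\<forall>b\<in>sp_bas P {}. lin (sp_eps Q) (\<phi> {} b) = sp_eps P b)"

definition db_morphism :: "('b, 'k::comm_semiring_1, 'z) twsp_scheme \<Rightarrow> ('c, 'k, 'y) twsp_scheme
     \<Rightarrow> (nat set \<Rightarrow> 'b \<Rightarrow> 'c \<Rightarrow> 'k) \<Rightarrow> bool" where
  "db_morphism P Q \<phi> \<longleftrightarrow>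
    tb_morphism P Q \<phi> \<and>
    (\<forall>A. finite A \<longrightarrow> (\<forall>b\<in>sp_bas P A.
       deltav Q A (\<phi> A b) = lext (tmap (\<phi> A) (\<phi> A)) (sp_delta P A b) \<and>
       lin (sp_eps2 Q A) (\<phi> A b) = sp_eps2 P A b))"

definition MorB :: "('b, 'k::comm_semiring_1, 'z) twsp_scheme \<Rightarrow> ('c, 'k, 'y) twsp_scheme
     \<Rightarrow> (nat set \<Rightarrow> 'b \<Rightarrow> 'c \<Rightarrow> 'k) set" where
  "MorB P Q = {\<phi>. tb_morphism P Q \<phi>}"

text \<open>Characters: twisted algebra morphisms P -> Com (Com[A] = K, trivial action,
product = product of scalars); f A is a linear form on P[A], given on the basis.\<close>
definition Char :: "('b, 'k::comm_semiring_1, 'z) twsp_scheme \<Rightarrow> (nat set \<Rightarrow> 'b \<Rightarrow> 'k) set" where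
  "Char P = {f. extensional_fam P f \<and>
    (\<forall>A. finite A \<longrightarrow> (\<forall>b\<in>sp_bas P A. \<forall>\<sigma>. inj_on \<sigma> A \<longrightarrow>
        lin (f (\<sigma> ` A)) (sp_act P \<sigma> A b) = f A b)) \<and>
    (\<forall>A B. finite A \<and> finite B \<and> A \<inter> B = {} \<longrightarrow>
      (\<forall>b\<in>sp_bas P A. \<forall>c\<in>sp_bas P B. lin (f (A \<union> B)) (sp_mul P A B b c) = f A b * f B c)) \<and>
    lin (f {}) (sp_unit P) = 1}"

definition comps :: "nat set \<Rightarrow> nat set list set" where
  "comps A = {xs. (\<forall>X\<in>set xs. X \<noteq> {}) \<and> \<Union>(set xs) = A \<and>
      (\<forall>i<length xs. \<forall>j<length xs. i \<noteq> j \<longrightarrow> xs ! i \<inter> xs ! j = {})}"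

text \<open>QSh(k,l), 0-based: surjections {0..<k+l} -> {0..<n} (as lists of values),
strictly increasing on the first k and on the last l positions.\<close>
definition QSh :: "nat \<Rightarrow> nat \<Rightarrow> nat list set" where
  "QSh k l = {s. length s = k + l \<and> (\<exists>n. set s = {..<n}) \<and>
      sorted_wrt (<) (take k s) \<and> sorted_wrt (<) (drop k s)}"

definition qsh_term :: "nat set list \<Rightarrow> nat set list \<Rightarrow> nat list \<Rightarrow> nat set list" where
  "qsh_term xs ys s =
     map (\<lambda>j. \<Union>{(xs @ ys) ! i | i. i < length xs + length ys \<and> s ! i = j}) [0..<card (set s)]"

definition qsh :: "nat set list \<Rightarrow> nat set list \<Rightarrow> nat set list \<Rightarrow> 'k::comm_semiring_1" where
  "qsh xs ys = (\<Sum>s\<in>QSh (length xs) (length ys). ind (qsh_term xs ys s))"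

definition qshv :: "(nat set list \<Rightarrow> 'k::comm_semiring_1) \<Rightarrow> (nat set list \<Rightarrow> 'k) \<Rightarrow> nat set list \<Rightarrow> 'k" where
  "qshv v w = lext (\<lambda>(x, y). qsh x y) (tens v w)"

definition cuts :: "'a list \<Rightarrow> 'a list list set" where
  "cuts xs = {ws. concat ws = xs \<and> [] \<notin> set ws}"

definition comp_delta :: "nat set list \<Rightarrow> nat set list \<times> nat set list \<Rightarrow> 'k::comm_semiring_1" where
  "comp_delta xs = (\<Sum>ws\<in>cuts xs.
      tens (ind (map (\<lambda>w. \<Union>(set w)) ws)) (foldr (\<lambda>w acc. qshv (ind w) acc) ws (ind [])))"

definition Comp :: "(nat set list, 'k::comm_semiring_1) twsp" where
  "Comp = \<lparr> sp_bas = comps,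
            sp_act = (\<lambda>\<sigma> A xs. ind (map ((`) \<sigma>) xs)),
            sp_mul = (\<lambda>A B xs ys. qsh xs ys),
            sp_unit = ind [],
            sp_Delta = (\<lambda>A B xs. (\<lambda>(p, q). if p @ q = xs \<and> \<Union>(set p) = A then 1 else 0)),
            sp_eps = (\<lambda>xs. if xs = [] then 1 else 0),
            sp_delta = (\<lambda>A xs. comp_delta xs),
            sp_eps2 = (\<lambda>A xs. if length xs = 1 \<or> xs = [] then 1 else 0) \<rparr>"

definition varsigma :: "('b, 'k::comm_semiring_1, 'z) twsp_scheme \<Rightarrow> (nat set \<Rightarrow> 'b \<Rightarrow> 'c \<Rightarrow> 'k)
     \<Rightarrow> (nat set \<Rightarrow> 'b \<Rightarrow> 'k) \<Rightarrow> nat set \<Rightarrow> 'b \<Rightarrow> 'c \<Rightarrow> 'k" where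
  "varsigma P \<phi> f = (\<lambda>A b. if finite A \<and> b \<in> sp_bas P A
      then lext (\<lambda>(x, y). (\<lambda>c. \<phi> A x c * f A y)) (sp_delta P A b) else (\<lambda>_. 0))"

definition varsigma' :: "(nat set \<Rightarrow> 'b \<Rightarrow> nat set list \<Rightarrow> 'k::comm_semiring_1) \<Rightarrow> nat set \<Rightarrow> 'b \<Rightarrow> 'k" where
  "varsigma' \<psi> = (\<lambda>A b. lin (sp_eps2 (Comp :: (nat set list, 'k) twsp) A) (\<psi> A b))"

end

theory Submission
  imports Defs
begin

text \<open>Iterating \<open>\<Delta>\<close> along the blocks of a composition and applying a character
  \<open>f\<close> to every factor gives the coefficients of a morphism to \<open>Comp\<close>; conversely every
  bialgebra morphism \<open>\<psi>\<close> arises in this way from \<open>\<epsilon>' \<circ> \<psi>\<close>, because \<open>\<psi>\<close>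
  commutes with \<open>\<Delta>\<close>. This is a bijection between characters and morphisms that does not
  involve \<open>\<delta>\<close>, and it leaves only one candidate \<open>\<phi>\<close> for a double morphism, the one
  attached to \<open>\<epsilon>'\<close>.

  On the side of \<open>Comp\<close> everything rests on two closed forms. Let \<open>C|S\<close> be the composition
  formed by the nonempty traces of the blocks of \<open>C\<close> on \<open>S\<close>. Then \<open>C\<close> occurs in the
  quasi-shuffle of \<open>X\<close> and \<open>Y\<close>, exactly once, iff \<open>X\<close> and \<open>Y\<close> are its
  restrictions, and \<open>C \<otimes> D\<close> occurs in \<open>\<delta>(E)\<close>, exactly once, iff \<open>E\<close> is the
  concatenation of the \<open>D|C\<^sub>i\<close>. With these, both \<open>\<phi> \<leftarrow> f\<close> being the morphism of \<open>f\<close>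
  and \<open>\<phi>\<close> respecting \<open>\<delta>\<close> become instances of one identity, obtained by
  iterating the compatibility of \<open>\<Delta>\<close> with \<open>\<delta>\<close>.\<close>

section \<open>Functionals on finitely supported vectors\<close>

lemma lin_eq_sum:
  assumes "finite S" "supp v \<subseteq> S"
  shows "lin f v = (\<Sum>b\<in>S. v b * f b)"
  unfolding lin_def by (rule sum.mono_neutral_left) (use assms in \<open>auto simp: supp_def\<close>)

lemma lin_cong_isvec:
  assumes "isvec S v" "\<And>b. b \<in> S \<Longrightarrow> f b = g b"
  shows "lin f v = lin g v"
  using assms unfolding lin_def isvec_def by (intro sum.cong) auto

lemma lin_ind [simp]: "lin f (ind b :: 'b \<Rightarrow> 'k::comm_semiring_1) = f b"
proof -
  have "supp (ind b :: 'b \<Rightarrow> 'k) = {b}" by (auto simp: supp_def ind_def)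
  then show ?thesis by (simp add: lin_def ind_def)
qed

lemma ind_apply: "ind b c = (if c = b then 1 else 0)"
  by (simp add: ind_def)

lemma supp_ind [simp]: "supp (ind b :: 'b \<Rightarrow> 'k::comm_semiring_1) = {b}"
  by (auto simp: supp_def ind_def)

lemma lin_zero [simp]: "lin (\<lambda>b. 0) v = 0"
  by (simp add: lin_def)

lemma lin_mult_left: "lin (\<lambda>b. k * f b) v = k * lin f v"
  unfolding lin_def sum_distrib_left by (simp add: mult_ac)

lemma lin_mult_right: "lin (\<lambda>b. f b * k) v = lin f v * k"
  unfolding lin_def sum_distrib_right by (simp add: mult_ac)

lemma lin_mult_prod: "lin f v * lin g w = lin (\<lambda>b. lin (\<lambda>c. f b * g c) w) v"
  by (simp add: lin_mult_left lin_mult_right)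

lemma lin_mult_case_left: "lin (\<lambda>(x, y). k * f x y) v = k * lin (\<lambda>(x, y). f x y) v"
  using lin_mult_left[of k "\<lambda>(x, y). f x y" v] by (simp add: case_prod_unfold)

lemma lin_mult_case_right: "lin (\<lambda>(x, y). f x y * k) v = lin (\<lambda>(x, y). f x y) v * k"
  using lin_mult_right[of "\<lambda>(x, y). f x y" k v] by (simp add: case_prod_unfold)

lemma finite_supp_lext:
  assumes "finite (supp v)" "\<And>b. b \<in> supp v \<Longrightarrow> finite (supp (f b))"
  shows "finite (supp (lext f v))"
proof (rule finite_subset)
  show "supp (lext f v) \<subseteq> (\<Union>b\<in>supp v. supp (f b))"
  proof
    fix c assume "c \<in> supp (lext f v)"
    then have "(\<Sum>b\<in>supp v. v b * f b c) \<noteq> 0" by (simp add: supp_def lext_def lin_def)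
    then obtain b where "b \<in> supp v" "v b * f b c \<noteq> 0" by (meson sum.not_neutral_contains_not_neutral)
    then show "c \<in> (\<Union>b\<in>supp v. supp (f b))" by (auto simp: supp_def intro!: bexI[of _ b])
  qed
qed (use assms in auto)

lemma lin_lext:
  assumes "finite (supp v)" "\<And>b. b \<in> supp v \<Longrightarrow> finite (supp (f b))"
  shows "lin g (lext f v) = lin (\<lambda>b. lin g (f b)) v"
proof -
  \<comment> \<open>A single finite set containing all supports involved turns both sides into the
    same double sum.\<close>
  let ?S = "(\<Union>b\<in>supp v. supp (f b)) \<union> supp (lext f v)"
  have fin: "finite ?S" using assms finite_supp_lext[OF assms] by auto
  have "lin g (lext f v) = (\<Sum>c\<in>?S. (\<Sum>b\<in>supp v. v b * f b c) * g c)"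
    using fin by (subst lin_eq_sum[of ?S]) (auto simp: lext_def lin_def)
  also have "\<dots> = (\<Sum>b\<in>supp v. \<Sum>c\<in>?S. v b * (f b c * g c))"
    unfolding sum_distrib_right by (subst sum.swap) (simp add: mult_ac)
  also have "\<dots> = (\<Sum>b\<in>supp v. v b * lin g (f b))"
    using fin by (intro sum.cong refl) (subst lin_eq_sum[of ?S], auto simp: sum_distrib_left)
  finally show ?thesis by (simp add: lin_def)
qed

lemma supp_tens: "supp (tens v w) \<subseteq> supp v \<times> supp (w :: 'c \<Rightarrow> 'k::comm_semiring_1)"
  by (auto simp: supp_def tens_def)

lemma finite_supp_tens:
  "finite (supp v) \<Longrightarrow> finite (supp w) \<Longrightarrow> finite (supp (tens v (w :: 'c \<Rightarrow> 'k::comm_semiring_1)))"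
  by (rule finite_subset[OF supp_tens]) simp

lemma lin_tens:
  assumes "finite (supp v)" "finite (supp w)"
  shows "lin g (tens v w) = lin (\<lambda>b. lin (\<lambda>c. g (b, c)) w) v"
proof -
  have "lin g (tens v w) = (\<Sum>x\<in>supp v \<times> supp w. tens v w x * g x)"
    using assms supp_tens by (intro lin_eq_sum) auto
  also have "\<dots> = (\<Sum>b\<in>supp v. \<Sum>c\<in>supp w. v b * w c * g (b, c))"
    by (subst sum.cartesian_product) (auto simp: tens_def intro!: sum.cong)
  finally show ?thesis by (simp add: lin_def sum_distrib_left mult_ac)
qed

lemma lin_smult: "lin g (\<lambda>c. k * v c) = k * lin g (v :: 'c \<Rightarrow> 'k::field)"
proof (cases "k = 0")
  case True then show ?thesis by (simp add: lin_def supp_def)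
next
  case False
  then have "supp (\<lambda>c. k * v c) = supp v" by (auto simp: supp_def)
  then show ?thesis by (simp add: lin_def sum_distrib_left mult_ac)
qed

lemma finite_supp_smult: "finite (supp v) \<Longrightarrow> finite (supp (\<lambda>c. k * v c :: 'k::comm_semiring_1))"
  by (rule finite_subset[of _ "supp v"]) (auto simp: supp_def)

text \<open>The function is the tensor D \<otimes> z with its brackets moved to a triple. The left
  sides of the coassociativity axioms and of the compatibility of \<Delta> with \<delta> are written
  in this shape.\<close>

lemma finite_supp_tens_assoc:
  assumes "finite (supp D)"
  shows "finite (supp (\<lambda>(p, q, r). D (p, q) * ind z r :: 'k::comm_semiring_1))"
  by (rule finite_subset[of _ "(\<lambda>(p, q). (p, q, z)) ` supp D"])
     (use assms in \<open>force simp: supp_def ind_def split: if_splits\<close>)+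

lemma lin_tens_assoc:
  assumes "finite (supp D)"
  shows "lin g (\<lambda>(p, q, r). D (p, q) * ind z r :: 'k::comm_semiring_1) = lin (\<lambda>(p, q). g (p, q, z)) D"
proof -
  let ?S = "(\<lambda>(p, q). (p, q, z)) ` supp D"
  have "lin g (\<lambda>(p, q, r). D (p, q) * ind z r) = (\<Sum>x\<in>?S. (case x of (p, q, r) \<Rightarrow> D (p, q) * ind z r) * g x)"
    using assms by (intro lin_eq_sum) (force simp: supp_def ind_def split: if_splits)+
  also have "\<dots> = (\<Sum>(p, q)\<in>supp D. D (p, q) * g (p, q, z))"
    by (subst sum.reindex) (auto simp: inj_on_def ind_def intro!: sum.cong)
  finally show ?thesis by (simp add: lin_def case_prod_unfold)
qed

lemma sum_fun_apply: "(\<Sum>s\<in>S. f s) x = (\<Sum>s\<in>S. f s x :: 'k::comm_monoid_add)"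
  by (induction S rule: infinite_finite_induct) auto

section \<open>Set compositions\<close>

lemma comps_Nil_iff [simp]: "[] \<in> comps A \<longleftrightarrow> A = {}"
  by (auto simp: comps_def)

text \<open>Disjointness is symmetric, so pairs of indices i < j suffice. This gives access to the
  rules of \<open>sorted_wrt\<close> for \<open>#\<close>, \<open>@\<close>, \<open>map\<close> and
  \<open>filter\<close>, hence to induction on lists.\<close>

lemma comps_alt: "xs \<in> comps A \<longleftrightarrow> {} \<notin> set xs \<and> \<Union> (set xs) = A \<and>
    sorted_wrt (\<lambda>X Y. X \<inter> Y = {}) xs"
proof -
  have "(\<forall>i<length xs. \<forall>j<length xs. i \<noteq> j \<longrightarrow> xs ! i \<inter> xs ! j = {}) \<longleftrightarrow>
    (\<forall>i j. i < j \<longrightarrow> j < length xs \<longrightarrow> xs ! i \<inter> xs ! j = {})"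
    (is "?L \<longleftrightarrow> ?R")
  proof
    assume R: ?R
    show ?L
    proof (intro allI impI)
      fix i j assume "i < length xs" "j < length xs" "i \<noteq> j"
      then show "xs ! i \<inter> xs ! j = {}"
        using R[rule_format, of i j] R[rule_format, of j i] by (cases i j rule: linorder_cases) auto
    qed
  qed auto
  moreover have "(\<forall>X\<in>set xs. X \<noteq> {}) \<longleftrightarrow> {} \<notin> set xs"
    by auto
  ultimately show ?thesis
    unfolding comps_def sorted_wrt_iff_nth_less mem_Collect_eq by (simp only:)
qed

lemma comps_Cons_iff: "C # cs \<in> comps A \<longleftrightarrow> C \<noteq> {} \<and> C \<subseteq> A \<and> cs \<in> comps (A - C)"
proof -
  have "(\<forall>X\<in>set cs. C \<inter> X = {}) \<longleftrightarrow> C \<inter> \<Union> (set cs) = {}"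
    unfolding disjoint_iff by blast
  moreover have "C \<union> U = A \<and> C \<inter> U = {} \<longleftrightarrow> C \<subseteq> A \<and> U = A - C" for U
    by auto
  ultimately show ?thesis unfolding comps_alt by (simp) metis
qed

lemma comps_Union: "xs \<in> comps A \<Longrightarrow> \<Union> (set xs) = A"
  by (simp add: comps_alt)

lemma comps_append_iff:
  "p @ q \<in> comps A \<longleftrightarrow> p \<in> comps (\<Union> (set p)) \<and> q \<in> comps (\<Union> (set q)) \<and>
     \<Union> (set p) \<inter> \<Union> (set q) = {} \<and> A = \<Union> (set p) \<union> \<Union> (set q)"
proof -
  have "(\<forall>x\<in>set p. \<forall>y\<in>set q. x \<inter> y = {}) \<longleftrightarrow> \<Union> (set p) \<inter> \<Union> (set q) = {}"
    unfolding disjoint_iff by blast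
  then show ?thesis unfolding comps_alt by (simp add: sorted_wrt_append) metis
qed

text \<open>Nonempty pairwise disjoint blocks are distinct, so only repetition-free lists of subsets
  of \<open>A\<close> occur.\<close>

lemma finite_comps:
  assumes "finite A" shows "finite (comps A)"
proof (rule finite_subset)
  have "distinct xs" if "xs \<in> comps A" for xs
  proof (use that in \<open>induction xs arbitrary: A\<close>)
    case (Cons C cs)
    then have "C \<noteq> {}" "cs \<in> comps (A - C)" by (auto simp: comps_Cons_iff)
    moreover from this have "C \<notin> set cs" by (force dest: comps_Union)
    ultimately show ?case using Cons.IH by auto
  qed simp
  then show "comps A \<subseteq> {xs. set xs \<subseteq> Pow A \<and> distinct xs}" by (auto dest: comps_Union)
qed (use assms in \<open>simp add: finite_subset_distinct\<close>)

section \<open>Restriction of set compositions to subsets\<close>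

definition restr :: "'a set list \<Rightarrow> 'a set \<Rightarrow> 'a set list" where
  "restr D S = filter (\<lambda>X. X \<noteq> {}) (map (\<lambda>X. X \<inter> S) D)"

lemma restr_Nil [simp]: "restr [] S = []"
  by (simp add: restr_def)

lemma restr_Cons: "restr (X # D) S = (if X \<inter> S = {} then restr D S else (X \<inter> S) # restr D S)"
  by (simp add: restr_def)

lemma Union_restr: "\<Union> (set (restr D S)) = \<Union> (set D) \<inter> S"
  by (induction D) (auto simp: restr_Cons)

lemma restr_in_comps:
  assumes "D \<in> comps A" "S \<subseteq> A"
  shows "restr D S \<in> comps S"
proof -
  have "sorted_wrt (\<lambda>X Y. X \<inter> Y = {}) (map (\<lambda>X. X \<inter> S) D)"
    unfolding sorted_wrt_map
    by (rule sorted_wrt_mono_rel[of _ "\<lambda>X Y. X \<inter> Y = {}"]) (blast, use assms in \<open>simp add: comps_alt\<close>)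
  then have "sorted_wrt (\<lambda>X Y. X \<inter> Y = {}) (restr D S)"
    unfolding restr_def by (rule sorted_wrt_filter)
  moreover have "\<Union> (set (restr D S)) = S"
    using assms by (auto simp: Union_restr dest: comps_Union)
  ultimately show ?thesis by (simp add: comps_alt) (simp add: restr_def)
qed

lemma restr_restr: "restr (restr D S) T = restr D (S \<inter> T)"
  by (induction D) (auto simp: restr_Cons Int_assoc)

lemma restr_cong: "\<Union> (set D) \<inter> S = \<Union> (set D) \<inter> T \<Longrightarrow> restr D S = restr D T"
  unfolding restr_def by (intro arg_cong[of _ _ "filter _"]) auto

lemma restr_id: "D \<in> comps A \<Longrightarrow> restr D A = D"
proof -
  assume "D \<in> comps A"
  then have "map (\<lambda>X. X \<inter> A) D = D" "{} \<notin> set D" by (auto simp: comps_alt intro!: map_idI)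
  then show ?thesis by (auto simp: restr_def intro!: filter_True)
qed

text \<open>The list \<open>concat (map (restr D) C)\<close> is the Tits product of \<open>C\<close>
  and \<open>D\<close>, the product of faces of the braid arrangement: each block of
  \<open>C\<close> is refined by the trace of \<open>D\<close> on it.\<close>

lemma concat_restr_in_comps:
  assumes D: "D \<in> comps U" and "C \<in> comps S" "S \<subseteq> U"
  shows "concat (map (restr D) C) \<in> comps S"
  using assms(2,3)
proof (induction C arbitrary: S)
  case (Cons X C)
  then have X: "X \<subseteq> S" and *: "restr D X \<in> comps X" "concat (map (restr D) C) \<in> comps (S - X)"
    using restr_in_comps[OF D, of X] by (auto simp: comps_Cons_iff)
  show ?case
    using X * comps_Union[OF *(1)] comps_Union[OF *(2)] by (simp add: comps_append_iff Un_absorb1)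
qed simp

lemma comps_single_iff: "[C] \<in> comps A \<longleftrightarrow> C \<noteq> {} \<and> C = A"
  by (auto simp: comps_Cons_iff)

text \<open>The composition on which the counit \<epsilon>' of \<open>Comp\<close> takes the value
  1. The empty set has no composition with one block; there \<open>[]\<close> takes its place, in
  line with the value of \<open>sp_eps2\<close> at \<open>[]\<close>.\<close>

definition one_block :: "'a set \<Rightarrow> 'a set list" where
  "one_block A = (if A = {} then [] else [A])"

lemma one_block_in_comps: "one_block A \<in> comps A"
  by (simp add: one_block_def comps_single_iff)

lemma restr_one_block: "S \<subseteq> A \<Longrightarrow> restr (one_block A) S = one_block S"
  by (auto simp: one_block_def restr_def Int_absorb1)

lemma comps_short_iff:
  "c \<in> comps A \<Longrightarrow> length c = 1 \<or> c = [] \<longleftrightarrow> c = one_block A"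
  by (auto simp: one_block_def length_Suc_conv comps_single_iff)

section \<open>The quasi-shuffle product and the second coproduct in closed form\<close>

text \<open>Indices of the blocks that survive in the restriction to \<open>S\<close>. For a
  quasi-shuffle \<open>C\<close> of compositions of \<open>A\<close> and \<open>B\<close> these
  lists for \<open>S = A\<close> and \<open>S = B\<close> recover the two halves of the surjection
  that produced \<open>C\<close>.\<close>

definition positions :: "'a set list \<Rightarrow> 'a set \<Rightarrow> nat list" where
  "positions C S = filter (\<lambda>j. C ! j \<inter> S \<noteq> {}) [0..<length C]"

lemma set_positions: "set (positions C S) = {j. j < length C \<and> C ! j \<inter> S \<noteq> {}}"
  by (auto simp: positions_def)

lemma sorted_positions: "sorted_wrt (<) (positions C S)"
  unfolding positions_def by (intro sorted_wrt_filter) simp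

lemma restr_eq_positions: "restr C S = map (\<lambda>j. C ! j \<inter> S) (positions C S)"
proof -
  have "map (\<lambda>X. X \<inter> S) C = map (\<lambda>j. C ! j \<inter> S) [0..<length C]"
    by (rule nth_equalityI) auto
  then show ?thesis by (simp add: restr_def positions_def filter_map o_def)
qed

lemma comps_nth_disjoint:
  "W \<in> comps U \<Longrightarrow> i < length W \<Longrightarrow> j < length W \<Longrightarrow> x \<in> W ! i \<Longrightarrow> x \<in> W ! j \<Longrightarrow> i = j"
  by (auto simp: comps_def)

text \<open>\<open>C\<close> is \<open>W\<close> with the blocks of equal value under \<open>s\<close> united, as in \<^const>\<open>qsh_term\<close>.\<close>

lemma restr_packed:
  fixes W :: "nat set list"
  assumes W: "W \<in> comps U" and s: "length s = length W" "set s = {..<n}"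
    and C: "C = map (\<lambda>j. \<Union> {W ! i | i. i < length W \<and> s ! i = j}) [0..<n]"
    and js: "set js \<subseteq> {..<length W}" "sorted_wrt (<) (map ((!) s) js)"
    and S: "S = (\<Union>i\<in>set js. W ! i)"
  shows "positions C S = map ((!) s) js" "restr C S = map ((!) W) js"
proof -
  have inj: "inj_on ((!) s) (set js)"
    using js(2) by (metis distinct_map strict_sorted_iff)
  have len: "s ! i < n" if "i < length W" for i
    using that s nth_mem by fastforce
  have lenC: "length C = n" by (simp add: C)
  have memC: "x \<in> C ! j \<longleftrightarrow> (\<exists>i<length W. s ! i = j \<and> x \<in> W ! i)" if "j < n" for j x
    using that by (auto simp: C)
  have in_js: "i \<in> set js" if "i < length W" "x \<in> W ! i" "x \<in> S" for i x
    using that js(1) comps_nth_disjoint[OF W] by (auto simp: S)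
  \<comment> \<open>A block of \<open>W\<close> merged with the \<open>i\<close>-th one either has
    its index outside \<open>js\<close>, and then is disjoint from \<open>S\<close>, or is the
    \<open>i\<close>-th block itself, as \<open>s\<close> is injective on \<open>js\<close>.\<close>
  have block: "C ! (s ! i) \<inter> S = W ! i" if i: "i \<in> set js" for i
  proof -
    have il: "i < length W" using i js(1) by auto
    show ?thesis
    proof
      show "C ! (s ! i) \<inter> S \<subseteq> W ! i"
      proof
        fix x assume "x \<in> C ! (s ! i) \<inter> S"
        then obtain i' where "i' < length W" "s ! i' = s ! i" "x \<in> W ! i'" "x \<in> S"
          using memC[OF len[OF il]] by blast
        moreover from this have "i' = i" using in_js inj i by (meson inj_onD)
        ultimately show "x \<in> W ! i" by simp
      qed
      show "W ! i \<subseteq> C ! (s ! i) \<inter> S"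
        using memC[OF len[OF il]] il i by (auto simp: S)
    qed
  qed
  \<comment> \<open>Both lists are strictly increasing, so equality of their sets of entries is
    enough.\<close>
  have "set (positions C S) = set (map ((!) s) js)"
  proof (intro set_eqI iffI)
    fix j assume "j \<in> set (positions C S)"
    then have j: "j < n" "C ! j \<inter> S \<noteq> {}" by (simp_all add: set_positions lenC)
    then obtain x where "x \<in> C ! j" "x \<in> S" by blast
    then show "j \<in> set (map ((!) s) js)" using memC[OF j(1)] in_js by auto
  next
    fix j assume "j \<in> set (map ((!) s) js)"
    then obtain i where i: "i \<in> set js" "j = s ! i" by auto
    moreover have "W ! i \<noteq> {}" using i js(1) W by (auto simp: comps_def)
    ultimately show "j \<in> set (positions C S)"
      using block[OF i(1)] js(1) len by (auto simp: set_positions lenC)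
  qed
  then show *: "positions C S = map ((!) s) js"
    using strict_sorted_equal sorted_positions js(2) by metis
  show "restr C S = map ((!) W) js"
    unfolding restr_eq_positions * using block by simp
qed

text \<open>The united blocks are nonempty because every value below \<open>n\<close> is attained,
  and disjoint because a point lies in only one block of \<open>W\<close>.\<close>

lemma packed_in_comps:
  fixes W :: "nat set list"
  assumes W: "W \<in> comps U" and s: "length s = length W" "set s = {..<n}"
  shows "map (\<lambda>j. \<Union> {W ! i | i. i < length W \<and> s ! i = j}) [0..<n] \<in> comps U"
    (is "map ?T _ \<in> _")
proof -
  have len: "s ! i < n" if "i < length W" for i
    using that s nth_mem by fastforce
  have "?T j \<noteq> {}" if "j < n" for j
  proof -
    have "j \<in> set s" using that s by simp
    then obtain i where "i < length s" "s ! i = j" by (metis in_set_conv_nth)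
    then have "i < length W" "s ! i = j" using s by auto
    moreover from this have "W ! i \<noteq> {}" using W by (auto simp: comps_def)
    ultimately show ?thesis by auto
  qed
  moreover have "(\<Union>j\<in>{0..<n}. ?T j) = U"
  proof -
    have U: "x \<in> U \<longleftrightarrow> (\<exists>i<length W. x \<in> W ! i)" for x
      using comps_Union[OF W] by (auto simp: set_conv_nth)
    show ?thesis
    proof
      show "(\<Union>j\<in>{0..<n}. ?T j) \<subseteq> U" using U by auto
      show "U \<subseteq> (\<Union>j\<in>{0..<n}. ?T j)"
      proof
        fix x assume "x \<in> U"
        then obtain i where i: "i < length W" "x \<in> W ! i" using U by auto
        show "x \<in> (\<Union>j\<in>{0..<n}. ?T j)"
        proof (rule UN_I)
          show "s ! i \<in> {0..<n}" using len[OF i(1)] by simp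
          show "x \<in> ?T (s ! i)" using i by auto
        qed
      qed
    qed
  qed
  moreover have "?T j \<inter> ?T j' = {}" if "j \<noteq> j'" for j j'
    using that comps_nth_disjoint[OF W] by (auto simp: disjoint_iff)
  ultimately show ?thesis unfolding comps_def by auto
qed

lemma QSh_finite: "finite (QSh k l)"
proof (rule finite_subset)
  show "QSh k l \<subseteq> {s. set s \<subseteq> {..<k + l} \<and> length s = k + l}"
  proof
    fix s assume s: "s \<in> QSh k l"
    then obtain n where "length s = k + l" "set s = {..<n}" by (auto simp: QSh_def)
    moreover from this have "n \<le> k + l" by (metis card_length card_lessThan)
    ultimately show "s \<in> {s. set s \<subseteq> {..<k + l} \<and> length s = k + l}" by auto
  qed
qed (simp add: finite_lists_length_eq)

lemma map_nth_append_left: "map ((!) (xs @ ys)) [0..<length xs] = xs"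
  by (rule nth_equalityI) (auto simp: nth_append)

lemma map_nth_append_right: "map ((!) (xs @ ys)) [length xs..<length xs + length ys] = ys"
  by (rule nth_equalityI) (auto simp: nth_append)

text \<open>A quasi-shuffle is strictly increasing on each factor, so it never merges two blocks of
  the same factor. Hence restriction undoes it, and the surjection can be read off from the
  result.\<close>

lemma qsh_term_restr:
  assumes X: "X \<in> comps A" and Y: "Y \<in> comps B" and AB: "A \<inter> B = {}"
    and s: "s \<in> QSh (length X) (length Y)"
  defines "C \<equiv> qsh_term X Y s"
  shows "C \<in> comps (A \<union> B)" "restr C A = X" "restr C B = Y"
    "s = positions C A @ positions C B"
proof -
  from s obtain n where len: "length s = length X + length Y" and n: "set s = {..<n}"
    and srt: "sorted_wrt (<) (take (length X) s)" "sorted_wrt (<) (drop (length X) s)"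
    by (auto simp: QSh_def)
  define W where "W = X @ Y"
  have W: "W \<in> comps (A \<union> B)"
    using X Y AB by (auto simp: W_def comps_append_iff comps_Union)
  have lenW: "length s = length W" using len by (simp add: W_def)
  have C: "C = map (\<lambda>j. \<Union> {W ! i | i. i < length W \<and> s ! i = j}) [0..<n]"
    by (simp add: C_def qsh_term_def W_def n)
  show "C \<in> comps (A \<union> B)" unfolding C using W lenW n by (rule packed_in_comps)
  define t u where "t = take (length X) s" and "u = drop (length X) s"
  have su: "s = t @ u" and lt: "length t = length X" and lu: "length u = length Y"
    using len by (auto simp: t_def u_def)
  have mt: "map ((!) s) [0..<length X] = t" unfolding su lt[symmetric] by (rule map_nth_append_left)
  have mu: "map ((!) s) [length X..<length X + length Y] = u"
    unfolding su lt[symmetric] lu[symmetric] by (rule map_nth_append_right)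
  have mX: "map ((!) W) [0..<length X] = X" unfolding W_def by (rule map_nth_append_left)
  have mY: "map ((!) W) [length X..<length X + length Y] = Y"
    unfolding W_def by (rule map_nth_append_right)
  have SA: "A = (\<Union>i\<in>set [0..<length X]. W ! i)"
    using arg_cong[OF mX, of "\<lambda>z. \<Union> (set z)"] comps_Union[OF X] by simp
  have SB: "B = (\<Union>i\<in>set [length X..<length X + length Y]. W ! i)"
    using arg_cong[OF mY, of "\<lambda>z. \<Union> (set z)"] comps_Union[OF Y] by simp
  have sub: "set [0..<length X] \<subseteq> {..<length W}"
    "set [length X..<length X + length Y] \<subseteq> {..<length W}" by (auto simp: W_def)
  have srt': "sorted_wrt (<) (map ((!) s) [0..<length X])"
    "sorted_wrt (<) (map ((!) s) [length X..<length X + length Y])"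
    unfolding mt mu using srt by (simp_all add: t_def u_def)
  note A = restr_packed[OF W lenW n C sub(1) srt'(1) SA, unfolded mt mX]
  note B = restr_packed[OF W lenW n C sub(2) srt'(2) SB, unfolded mu mY]
  show "restr C A = X" "restr C B = Y" "s = positions C A @ positions C B"
    using A B su by auto
qed

text \<open>The converse: each block of \<open>C\<close> is nonempty and lies in
  \<open>A \<union> B\<close>, so it meets \<open>A\<close> or \<open>B\<close> and is the union of
  its two traces. The positions therefore hit every index and rebuild \<open>C\<close> from its
  restrictions.\<close>

lemma qsh_term_positions:
  assumes C: "C \<in> comps (A \<union> B)"
  defines "s \<equiv> positions C A @ positions C B"
  shows "s \<in> QSh (length (restr C A)) (length (restr C B))"
    "qsh_term (restr C A) (restr C B) s = C"
proof -
  have lA: "length (restr C A) = length (positions C A)"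
    and lB: "length (restr C B) = length (positions C B)"
    by (simp_all add: restr_eq_positions)
  have sub: "C ! j \<subseteq> A \<union> B" "C ! j \<noteq> {}" if "j < length C" for j
    using that comps_Union[OF C] C nth_mem by (fastforce simp: comps_def)+
  have set_s: "set s = {..<length C}"
    using sub by (auto simp: s_def set_positions disjoint_iff) blast
  then show "s \<in> QSh (length (restr C A)) (length (restr C B))"
    using sorted_positions by (auto simp: QSh_def lA lB s_def)
  let ?W = "restr C A @ restr C B"
  have left: "s ! i \<in> set (positions C A) \<and> ?W ! i = C ! (s ! i) \<inter> A" if "i < length (positions C A)" for i
    using that by (simp add: s_def restr_eq_positions nth_append)
  have right: "s ! i \<in> set (positions C B) \<and> ?W ! i = C ! (s ! i) \<inter> B"
    if "i \<ge> length (positions C A)" "i < length ?W" for i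
    using that by (simp add: s_def restr_eq_positions nth_append)
  have sub': "?W ! i \<subseteq> C ! (s ! i)" if "i < length ?W" for i
    using that left[of i] right[of i] by (cases "i < length (positions C A)") auto
  have "\<Union> {?W ! i | i. i < length ?W \<and> s ! i = j} = C ! j" if j: "j < length C" for j
  proof
    show "\<Union> {?W ! i | i. i < length ?W \<and> s ! i = j} \<subseteq> C ! j"
      using sub' by auto
    show "C ! j \<subseteq> \<Union> {?W ! i | i. i < length ?W \<and> s ! i = j}"
    proof
      fix x assume x: "x \<in> C ! j"
      then consider "x \<in> A" | "x \<in> B" using sub[OF j] by auto
      then obtain i where "i < length ?W" "s ! i = j" "x \<in> ?W ! i"
      proof cases
        case 1
        then have "j \<in> set (positions C A)" using x j by (auto simp: set_positions)
        then obtain i where i: "i < length (positions C A)" "positions C A ! i = j"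
          by (auto simp: in_set_conv_nth)
        then have "s ! i = j" by (simp add: s_def nth_append)
        with i 1 x left[of i] that[of i] lA show ?thesis by auto
      next
        case 2
        then have "j \<in> set (positions C B)" using x j by (auto simp: set_positions)
        then obtain i where i: "i < length (positions C B)" "positions C B ! i = j"
          by (auto simp: in_set_conv_nth)
        let ?i = "length (positions C A) + i"
        have "s ! ?i = j" using i by (simp add: s_def nth_append)
        with i 2 x right[of ?i] that[of ?i] lA lB show ?thesis by auto
      qed
      then show "x \<in> \<Union> {?W ! i | i. i < length ?W \<and> s ! i = j}" by blast
    qed
  qed
  then show "qsh_term (restr C A) (restr C B) s = C"
    unfolding qsh_term_def set_s by (intro nth_equalityI) auto
qed

text \<open>By the two preceding lemmas the surjection is determined by \<open>C\<close>, so no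
  composition is produced twice and the sum collapses to the single index \<open>?s\<close>.\<close>

lemma qsh_coeff:
  assumes X: "X \<in> comps A" and Y: "Y \<in> comps B" and AB: "A \<inter> B = {}"
  shows "qsh X Y C = (if C \<in> comps (A \<union> B) \<and> restr C A = X \<and> restr C B = Y then 1
    else 0 :: 'k::comm_semiring_1)" (is "_ = (if ?Q then 1 else 0)")
proof -
  let ?s = "positions C A @ positions C B"
  have "qsh_term X Y s = C \<longleftrightarrow> ?Q \<and> s = ?s" if "s \<in> QSh (length X) (length Y)" for s
  proof
    assume "qsh_term X Y s = C"
    then show "?Q \<and> s = ?s" using qsh_term_restr[OF X Y AB that] by auto
  next
    assume "?Q \<and> s = ?s"
    then show "qsh_term X Y s = C" using qsh_term_positions(2)[of C A B] by auto
  qed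
  then have "qsh X Y C = (\<Sum>s\<in>QSh (length X) (length Y). if ?Q \<and> s = ?s then 1 else 0 :: 'k)"
    unfolding qsh_def sum_fun_apply by (intro sum.cong) (simp_all add: ind_apply eq_commute[of C])
  also have "\<dots> = (if ?Q \<and> ?s \<in> QSh (length X) (length Y) then 1 else 0)"
    by (cases ?Q) (auto simp: QSh_finite)
  also have "\<dots> = (if ?Q then 1 else 0)"
    using qsh_term_positions(1)[of C A B] by auto
  finally show ?thesis .
qed

lemma lin_if_eq:
  "finite (supp w) \<Longrightarrow> lin (\<lambda>y. if r = y then k else 0) w = w r * (k :: 'k::comm_semiring_1)"
  by (auto simp: lin_def supp_def if_distrib sum.delta' cong: if_cong)

lemma isvec_finite: "isvec S v \<Longrightarrow> finite (supp v)"
  by (simp add: isvec_def)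

lemma isvec_zero: "isvec S v \<Longrightarrow> b \<notin> S \<Longrightarrow> v b = 0"
  by (auto simp: isvec_def supp_def)

lemma isvec_tens: "isvec S v \<Longrightarrow> isvec T w \<Longrightarrow> isvec (S \<times> T) (tens v (w :: 'c \<Rightarrow> 'k::comm_semiring_1))"
  using supp_tens[of v w] finite_supp_tens[of v w] unfolding isvec_def by blast

text \<open>Only one pair of basis elements contributes to the coefficient at \<open>C\<close>,
  namely its two restrictions.\<close>

lemma qshv_coeff:
  assumes v: "isvec (comps A) v" and w: "isvec (comps B) w" and AB: "A \<inter> B = {}"
  shows "qshv v w C = (if C \<in> comps (A \<union> B) then v (restr C A) * w (restr C B)
    else 0 :: 'k::comm_semiring_1)"
proof -
  have "qshv v w C = lin (\<lambda>x. lin (\<lambda>y. qsh x y C) w) v"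
    unfolding qshv_def lext_def using v w by (subst lin_tens) (auto simp: isvec_def)
  also have "\<dots> = lin (\<lambda>x. lin (\<lambda>y. if restr C B = y then
      (if restr C A = x then (if C \<in> comps (A \<union> B) then 1 else 0) else 0) else 0) w) v"
    by (intro lin_cong_isvec[OF v] lin_cong_isvec[OF w]) (simp add: qsh_coeff[OF _ _ AB])
  also have "\<dots> = v (restr C A) * (w (restr C B) * (if C \<in> comps (A \<union> B) then 1 else 0))"
    unfolding lin_if_eq[OF isvec_finite[OF w]] lin_mult_left lin_if_eq[OF isvec_finite[OF v]]
    by (simp add: mult_ac)
  finally show ?thesis by simp
qed

text \<open>Serves the right tensor factor of \<open>comp_delta\<close>. In the induction,
  restricting to a later factor can be done inside the union \<open>B\<close> of the later supports,
  by \<open>restr_restr\<close>.\<close>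

lemma foldr_qshv_coeff:
  assumes "finite A" "concat ws \<in> comps A"
  shows "foldr (\<lambda>w acc. qshv (ind w) acc) ws (ind []) D =
    (if D \<in> comps A \<and> (\<forall>w\<in>set ws. restr D (\<Union> (set w)) = w) then 1 else 0 :: 'k::comm_semiring_1)"
  using assms
proof (induction ws arbitrary: A D)
  case Nil
  then have A: "A = {}" by simp
  have "D \<in> comps {} \<longleftrightarrow> D = []" by (cases D) (auto simp: comps_Cons_iff)
  then show ?case by (simp add: ind_def A)
next
  case (Cons w ws)
  define S where "S = \<Union> (set w)"
  define B where "B = \<Union> (set (concat ws))"
  have w: "w \<in> comps S" and ws: "concat ws \<in> comps B" and SB: "S \<inter> B = {}" and A: "A = S \<union> B"
    using Cons.prems(2) comps_append_iff[of w "concat ws" A] by (simp_all add: S_def B_def)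
  have B: "finite B" using Cons.prems(1) A by simp
  let ?acc = "foldr (\<lambda>w acc. qshv (ind w) acc) ws (ind []) :: _ \<Rightarrow> 'k"
  note IH = Cons.IH[OF B ws]
  have "supp ?acc \<subseteq> comps B" unfolding supp_def by (auto simp: IH split: if_splits)
  then have "isvec (comps B) ?acc"
    unfolding isvec_def using finite_subset finite_comps[OF B] by blast
  then have "qshv (ind w) ?acc D = (if D \<in> comps A then ind w (restr D S) * ?acc (restr D B) else 0)"
    unfolding A using w by (intro qshv_coeff SB) (simp_all add: isvec_def)
  moreover have "restr (restr D B) (\<Union> (set v)) = restr D (\<Union> (set v))" if "v \<in> set ws" for v
  proof -
    have "\<Union> (set v) \<subseteq> B" using that by (auto simp: B_def)
    then show ?thesis by (simp add: restr_restr Int_absorb1)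
  qed
  moreover have "restr D B \<in> comps B" if "D \<in> comps A"
    using that A by (intro restr_in_comps) auto
  ultimately show ?case by (auto simp: IH ind_apply[of w "restr D (\<Union> (set w))"] ind_apply[of w w] S_def)
qed

section \<open>Cuts of a composition and the second coproduct of \<open>Comp\<close>\<close>

lemma finite_cuts: "finite (cuts xs)"
proof (rule finite_subset)
  let ?W = "{w. set w \<subseteq> set xs \<and> length w \<le> length xs}"
  have "length ws \<le> length (concat ws)" if "[] \<notin> set ws" for ws :: "'a list list"
    using that
  proof (induction ws)
    case (Cons w ws)
    then have "length ws \<le> length (concat ws)" by simp
    moreover have "length w \<ge> 1" using Cons.prems by (cases w) auto
    ultimately show ?case by simp
  qed simp
  moreover have "length w \<le> length (concat ws)" if "w \<in> set ws" for w and ws :: "'a list list"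
    using that by (induction ws) auto
  ultimately show "cuts xs \<subseteq> {ws. set ws \<subseteq> ?W \<and> length ws \<le> length xs}"
    by (force simp: cuts_def)
  show "finite {ws. set ws \<subseteq> ?W \<and> length ws \<le> length xs}"
    by (intro finite_lists_length_le) simp
qed

lemma Union_blocks_in_comps:
  "concat ws \<in> comps A \<Longrightarrow> [] \<notin> set ws \<Longrightarrow> map (\<lambda>w. \<Union> (set w)) ws \<in> comps A"
proof (induction ws arbitrary: A)
  case (Cons w ws)
  define S where "S = \<Union> (set w)"
  define B where "B = \<Union> (set (concat ws))"
  have w: "w \<in> comps S" and ws: "concat ws \<in> comps B" and SB: "S \<inter> B = {}" and A: "A = S \<union> B"
    using Cons.prems(1) comps_append_iff[of w "concat ws" A] by (simp_all add: S_def B_def)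
  have "S \<noteq> {}" using w Cons.prems(2) by (cases w) (auto simp: comps_Cons_iff)
  moreover have "A - S = B" using SB A by auto
  ultimately show ?case
    using Cons.IH[OF ws] Cons.prems(2) A by (simp add: comps_Cons_iff S_def[symmetric])
qed simp

text \<open>Once \<open>C\<close> and \<open>D\<close> are given, the cut is forced to consist of
  the restrictions of \<open>D\<close> to the blocks of \<open>C\<close>, so at most one summand
  survives. In other words, the second coproduct is dual to the Tits product.\<close>

lemma comp_delta_coeff:
  assumes A: "finite A" and E: "E \<in> comps A"
  shows "comp_delta E (C, D) = (if C \<in> comps A \<and> D \<in> comps A \<and> concat (map (restr D) C) = E
    then 1 else 0 :: 'k::comm_semiring_1)" (is "_ = (if ?Q then 1 else 0)")
proof -
  let ?R = "C \<in> comps A \<and> D \<in> comps A" and ?ws = "map (restr D) C"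
  have eq: "map (\<lambda>w. \<Union> (set w)) ws = C \<and> D \<in> comps A \<and> (\<forall>w\<in>set ws. restr D (\<Union> (set w)) = w)
      \<longleftrightarrow> ?R \<and> ?ws = ws" (is "?lhs \<longleftrightarrow> ?rhs") if ws: "ws \<in> cuts E" for ws
  proof
    assume l: ?lhs
    moreover from l have "map (restr D) C = ws" by (auto intro!: map_idI)
    moreover have "map (\<lambda>w. \<Union> (set w)) ws \<in> comps A"
      using ws E by (intro Union_blocks_in_comps) (auto simp: cuts_def)
    ultimately show ?rhs by auto
  next
    assume r: ?rhs
    then have "\<Union> (set (restr D X)) = X" if "X \<in> set C" for X
      using that by (auto simp: Union_restr dest!: comps_Union)
    then show ?lhs using r by (auto intro!: map_idI)
  qed
  have "comp_delta E (C, D) = (\<Sum>ws\<in>cuts E. if ?R \<and> ?ws = ws then 1 else 0 :: 'k)"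
    unfolding comp_delta_def sum_fun_apply
  proof (intro sum.cong refl)
    fix ws assume ws: "ws \<in> cuts E"
    then have c: "concat ws \<in> comps A" using E by (simp add: cuts_def)
    show "tens (ind (map (\<lambda>w. \<Union> (set w)) ws)) (foldr (\<lambda>w acc. qshv (ind w) acc) ws (ind [])) (C, D)
      = (if ?R \<and> ?ws = ws then 1 else 0 :: 'k)"
      unfolding eq[OF ws, symmetric] tens_def prod.case foldr_qshv_coeff[OF A c]
      by (auto simp: ind_apply)
  qed
  also have "\<dots> = (if ?R \<and> ?ws \<in> cuts E then 1 else 0)"
    by (cases ?R) (auto simp: finite_cuts)
  also have "?R \<and> ?ws \<in> cuts E \<longleftrightarrow> ?Q"
  proof -
    \<comment> \<open>The cuts have no empty pieces; the trace of \<open>D\<close> on a nonempty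
      block of \<open>C\<close> is never empty, since \<open>D\<close> covers
      \<open>A\<close>.\<close>
    have "[] \<notin> set ?ws" if ?R
    proof
      assume "[] \<in> set ?ws"
      then obtain X where X: "X \<in> set C" "restr D X = []" by auto
      have "X \<subseteq> A" "\<Union> (set D) = A" using X(1) that comps_Union[of C] comps_Union[of D] by auto
      then have "X = {}" using Union_restr[of D X] X(2) by auto
      then show False using X that by (auto simp: comps_def)
    qed
    then show ?thesis by (auto simp: cuts_def)
  qed
  finally show ?thesis .
qed

section \<open>Structure maps of \<open>Comp\<close> on arbitrary vectors\<close>

lemma bas_Comp [simp]: "sp_bas Comp = comps"
  and unit_Comp [simp]: "sp_unit Comp = ind []"
  and eps_Comp [simp]: "sp_eps Comp = (\<lambda>xs. if xs = [] then 1 else 0)"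
  by (simp_all add: Comp_def)

lemma mulv_Comp_coeff:
  assumes "isvec (comps A) v" "isvec (comps B) w" "A \<inter> B = {}"
  shows "mulv Comp A B (tens v w) C =
    (if C \<in> comps (A \<union> B) then v (restr C A) * w (restr C B) else 0 :: 'k::comm_semiring_1)"
  using qshv_coeff[OF assms, of C] by (simp add: mulv_def Comp_def qshv_def)

lemma Deltav_Comp_coeff:
  assumes "finite (supp v)"
  shows "Deltav Comp A B v (p, q) = (if \<Union> (set p) = A then v (p @ q) else 0 :: 'k::comm_semiring_1)"
  using lin_if_eq[OF assms, of "p @ q" 1]
  by (simp add: Deltav_def Comp_def lext_def)

lemma deltav_Comp_coeff:
  assumes A: "finite A" and v: "isvec (comps A) v"
  shows "deltav Comp A v (C, D) = (if C \<in> comps A \<and> D \<in> comps A then v (concat (map (restr D) C))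
    else 0 :: 'k::comm_semiring_1)"
proof -
  have "deltav Comp A v (C, D) = lin (\<lambda>E. if concat (map (restr D) C) = E then
      (if C \<in> comps A \<and> D \<in> comps A then 1 else 0) else 0) v"
    unfolding deltav_def lext_def
    by (rule lin_cong_isvec[OF v]) (auto simp: Comp_def comp_delta_coeff[OF A])
  then show ?thesis by (simp add: lin_if_eq[OF isvec_finite[OF v]])
qed

lemma eps2_Comp:
  assumes "isvec (comps A) v"
  shows "lin (sp_eps2 Comp A) v = (v (one_block A) :: 'k::comm_semiring_1)"
proof -
  have "lin (sp_eps2 Comp A) v = lin (\<lambda>c. if one_block A = c then 1 else 0) v"
    by (rule lin_cong_isvec[OF assms]) (use comps_short_iff in \<open>force simp: Comp_def\<close>)
  then show ?thesis by (simp add: lin_if_eq[OF isvec_finite[OF assms]])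
qed

lemma comps_image:
  assumes "inj_on \<sigma> A"
  shows "comps (\<sigma> ` A) = map ((`) \<sigma>) ` comps A"
proof (intro set_eqI iffI)
  fix d assume d: "d \<in> comps (\<sigma> ` A)"
  \<comment> \<open>Preimages are cut down to \<open>A\<close> because \<sigma> is a total function
    that is only known to be injective there.\<close>
  let ?c = "map (\<lambda>X. \<sigma> -` X \<inter> A) d"
  have im: "\<sigma> ` (\<sigma> -` X \<inter> A) = X" if "X \<in> set d" for X
  proof -
    have "X \<subseteq> \<sigma> ` A" using that comps_Union[OF d] by auto
    then show ?thesis by auto
  qed
  have "map ((`) \<sigma>) ?c = d" using im by (auto intro!: map_idI)
  moreover have "?c \<in> comps A"
  proof -
    have "sorted_wrt (\<lambda>X Y. X \<inter> Y = {}) ?c"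
      unfolding sorted_wrt_map
      by (rule sorted_wrt_mono_rel[of _ "\<lambda>X Y. X \<inter> Y = {}"]) (blast, use d in \<open>simp add: comps_alt\<close>)
    moreover have "{} \<notin> set ?c" using im d by (force simp: comps_def)
    moreover have "\<Union> (set ?c) = \<sigma> -` \<Union> (set d) \<inter> A" by auto
    then have "\<Union> (set ?c) = A" unfolding comps_Union[OF d] by auto
    ultimately show ?thesis by (simp add: comps_alt)
  qed
  ultimately show "d \<in> map ((`) \<sigma>) ` comps A" by (metis imageI)
next
  fix d assume "d \<in> map ((`) \<sigma>) ` comps A"
  then obtain c where c: "c \<in> comps A" and d: "d = map ((`) \<sigma>) c" by auto
  have "sorted_wrt (\<lambda>X Y. X \<inter> Y = {}) d"
    unfolding d sorted_wrt_map
  proof (rule sorted_wrt_mono_rel[of _ "\<lambda>X Y. X \<inter> Y = {}"])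
    fix X Y assume "X \<in> set c" "Y \<in> set c" "X \<inter> Y = {}"
    moreover from this have "X \<subseteq> A" "Y \<subseteq> A" using comps_Union[OF c] by auto
    ultimately show "\<sigma> ` X \<inter> \<sigma> ` Y = {}"
      using inj_on_image_Int[OF assms, of X Y] by simp
  qed (use c in \<open>simp add: comps_alt\<close>)
  moreover have "{} \<notin> set d" using c by (auto simp: d comps_def)
  moreover have "\<Union> (set d) = \<sigma> ` A" using comps_Union[OF c] by (auto simp: d)
  ultimately show "d \<in> comps (\<sigma> ` A)" by (simp add: comps_alt)
qed

text \<open>By \<open>comps_image\<close> every composition of the image is a relabelled one, so
  this and \<open>actv_Comp_zero\<close> determine all coefficients.\<close>

lemma actv_Comp_coeff:
  assumes v: "isvec (comps A) v" and inj: "inj_on \<sigma> A" and c: "c \<in> comps A"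
  shows "actv Comp \<sigma> A v (map ((`) \<sigma>) c) = (v c :: 'k::comm_semiring_1)"
proof -
  have "map ((`) \<sigma>) c = map ((`) \<sigma>) b \<longleftrightarrow> c = b" if "b \<in> comps A" for b
  proof (rule inj_on_map_eq_map)
    have "set c \<union> set b \<subseteq> Pow A" using c that by (auto dest: comps_Union)
    then show "inj_on ((`) \<sigma>) (set c \<union> set b)" using inj_on_image_Pow[OF inj] inj_on_subset by blast
  qed
  then have "actv Comp \<sigma> A v (map ((`) \<sigma>) c) = lin (\<lambda>b. if c = b then 1 else 0) v"
    unfolding actv_def lext_def by (intro lin_cong_isvec[OF v]) (auto simp: Comp_def ind_def)
  then show ?thesis by (simp add: lin_if_eq[OF isvec_finite[OF v]])
qed

lemma actv_Comp_zero:
  assumes v: "isvec (comps A) v" and inj: "inj_on \<sigma> A" and d: "d \<notin> comps (\<sigma> ` A)"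
  shows "actv Comp \<sigma> A v d = (0 :: 'k::comm_semiring_1)"
proof -
  have "actv Comp \<sigma> A v d = lin (\<lambda>b. 0) v"
    unfolding actv_def lext_def
    by (intro lin_cong_isvec[OF v]) (use d comps_image[OF inj] in \<open>auto simp: Comp_def ind_def\<close>)
  then show ?thesis by (simp add: lin_def)
qed

section \<open>Functional forms of the axioms\<close>

text \<open>The axioms are equalities of vectors written with \<open>lext\<close>. Pairing such an
  equality with an arbitrary functional \<open>g\<close> gives an equality of nested
  \<open>lin\<close>, in which bound variables replace the handling of tensor factors.\<close>

lemma lin_lext_isvec:
  assumes "isvec S v" "\<And>b. b \<in> S \<Longrightarrow> finite (supp (f b))" "\<And>b. b \<in> S \<Longrightarrow> lin g (f b) = h b"
  shows "lin g (lext f v) = lin h v"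
proof -
  have "lin g (lext f v) = lin (\<lambda>b. lin g (f b)) v"
    using assms(1,2) by (intro lin_lext) (auto simp: isvec_def)
  then show ?thesis using lin_cong_isvec[OF assms(1), of "\<lambda>b. lin g (f b)" h] assms(3) by simp
qed

lemma lin_scaled_ind:
  "lin g (\<lambda>z. k * ind y z) = k * (g y :: 'k::field)"
  "lin g (\<lambda>z. ind y z * k) = k * (g y :: 'k::field)"
  by (simp_all add: lin_smult mult.commute[of _ k])

lemma finite_supp_scaled_ind:
  "finite (supp (\<lambda>z. k * ind y z :: 'k::field))" "finite (supp (\<lambda>z. ind y z * k :: 'k::field))"
  by (simp_all add: finite_supp_smult mult.commute[of _ k])

locale connected_double_twisted_bialgebra =
  fixes P :: "('b, 'k::field) twsp"
  assumes double: "double_twisted_bialgebra P" and connected: "connected P"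
begin

abbreviation "bas \<equiv> sp_bas P"
abbreviation "act \<equiv> sp_act P"
abbreviation "mul \<equiv> sp_mul P"
abbreviation "unit \<equiv> sp_unit P"
abbreviation "Del \<equiv> sp_Delta P"
abbreviation "eps \<equiv> sp_eps P"
abbreviation "del \<equiv> sp_delta P"

lemma bialg: "twisted_bialgebra P"
  and spec: "species P"
  and alg: "twisted_algebra P"
  and coalg: "twisted_coalgebra P"
  using double by (auto simp: double_twisted_bialgebra_def twisted_bialgebra_def)

lemmas species_axioms = spec [unfolded species_def]
lemmas algebra_axioms = alg [unfolded twisted_algebra_def]
lemmas coalgebra_axioms = coalg [unfolded twisted_coalgebra_def]
lemmas bialgebra_axioms = bialg [unfolded twisted_bialgebra_def]
lemmas double_axioms = double [unfolded double_twisted_bialgebra_def]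

lemmas Del_axioms = coalgebra_axioms [THEN conjunct1, rule_format]
lemmas del_axioms = double_axioms [THEN conjunct2, THEN conjunct1, rule_format]

lemma act_isvec:
  "finite A \<Longrightarrow> inj_on \<sigma> A \<Longrightarrow> b \<in> bas A \<Longrightarrow> isvec (bas (\<sigma> ` A)) (act \<sigma> A b)"
  by (rule species_axioms [THEN conjunct1, rule_format]) auto

lemma act_id: "finite A \<Longrightarrow> (\<And>x. x \<in> A \<Longrightarrow> \<sigma> x = x) \<Longrightarrow> b \<in> bas A \<Longrightarrow> act \<sigma> A b = ind b"
  by (rule species_axioms [THEN conjunct2, THEN conjunct2, THEN conjunct1, rule_format]) auto

lemma act_comp:
  "finite A \<Longrightarrow> inj_on \<sigma> A \<Longrightarrow> inj_on \<tau> (\<sigma> ` A) \<Longrightarrow> b \<in> bas A \<Longrightarrow>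
     act (\<tau> \<circ> \<sigma>) A b = lext (act \<tau> (\<sigma> ` A)) (act \<sigma> A b)"
  unfolding actv_def [symmetric]
  by (rule species_axioms [THEN conjunct2, THEN conjunct2, THEN conjunct2, rule_format]) auto

lemma mul_isvec:
  "finite A \<Longrightarrow> finite B \<Longrightarrow> A \<inter> B = {} \<Longrightarrow> b \<in> bas A \<Longrightarrow> c \<in> bas B \<Longrightarrow>
     isvec (bas (A \<union> B)) (mul A B b c)"
  by (rule algebra_axioms [THEN conjunct1, rule_format, THEN conjunct1]) auto

lemma unit_isvec: "isvec (bas {}) unit"
  by (rule algebra_axioms [THEN conjunct2, THEN conjunct2, THEN conjunct1])

lemma Del_isvec:
  "finite A \<Longrightarrow> finite B \<Longrightarrow> A \<inter> B = {} \<Longrightarrow> b \<in> bas (A \<union> B) \<Longrightarrow> isvec (bas A \<times> bas B) (Del A B b)"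
  by (rule Del_axioms [THEN conjunct1]) auto

lemma del_isvec: "finite A \<Longrightarrow> b \<in> bas A \<Longrightarrow> isvec (bas A \<times> bas A) (del A b)"
  by (rule del_axioms [THEN conjunct1]) auto

text \<open>Rewriting under a coproduct. In Sweedler notation
  \<open>lin (\<lambda>(u, v). f u v) (Del A B b)\<close> is the sum of the values of
  \<open>f\<close> on the two legs of \<Delta>(b).\<close>

lemma lin_Del_cong:
  assumes "finite A" "finite B" "A \<inter> B = {}" "b \<in> bas (A \<union> B)"
    and "\<And>u v. u \<in> bas A \<Longrightarrow> v \<in> bas B \<Longrightarrow> f u v = g u v"
  shows "lin (\<lambda>(u, v). f u v) (Del A B b) = lin (\<lambda>(u, v). g u v) (Del A B b)"
  by (rule lin_cong_isvec[OF Del_isvec]) (use assms in auto)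

lemma lin_del_cong:
  assumes "finite A" "b \<in> bas A" and "\<And>u v. u \<in> bas A \<Longrightarrow> v \<in> bas A \<Longrightarrow> f u v = g u v"
  shows "lin (\<lambda>(u, v). f u v) (del A b) = lin (\<lambda>(u, v). g u v) (del A b)"
  by (rule lin_cong_isvec[OF del_isvec]) (use assms in auto)

lemma lin_coassoc:
  assumes fin: "finite A" "finite B" "finite C" and dis: "A \<inter> B = {}" "A \<inter> C = {}" "B \<inter> C = {}"
    and b: "b \<in> bas (A \<union> B \<union> C)"
  shows "lin (\<lambda>(x, z). lin (\<lambda>(p, q). h p q z) (Del A B x)) (Del (A \<union> B) C b) =
    lin (\<lambda>(x, y). lin (\<lambda>(q, r). h x q r) (Del B C y)) (Del A (B \<union> C) b)"
proof -
  let ?g = "\<lambda>(p, q, r). h p q r"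
  let ?L = "\<lambda>(x, z). (\<lambda>(p, q, r). Del A B x (p, q) * ind z r)"
  let ?R = "\<lambda>(x, y). tens (ind x) (Del B C y)"
  have "lin ?g (lext ?L (Del (A \<union> B) C b)) =
      lin (\<lambda>(x, z). lin (\<lambda>(p, q). h p q z) (Del A B x)) (Del (A \<union> B) C b)"
    by (rule lin_lext_isvec[OF Del_isvec])
      (use assms isvec_finite[OF Del_isvec] in \<open>auto simp: finite_supp_tens_assoc lin_tens_assoc\<close>)
  moreover have "lin ?g (lext ?R (Del A (B \<union> C) b)) =
      lin (\<lambda>(x, y). lin (\<lambda>(q, r). h x q r) (Del B C y)) (Del A (B \<union> C) b)"
    by (rule lin_lext_isvec[OF Del_isvec])
      (use assms isvec_finite[OF Del_isvec] in \<open>auto simp: finite_supp_tens lin_tens Un_assoc\<close>)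
  moreover have "lext ?L (Del (A \<union> B) C b) = lext ?R (Del A (B \<union> C) b)"
    by (rule coalgebra_axioms [THEN conjunct2, THEN conjunct1, rule_format]) (use assms in auto)
  ultimately show ?thesis by simp
qed

lemma lin_counit:
  assumes "finite A" "b \<in> bas A"
  shows "lin (\<lambda>(x, y). eps x * h y) (Del {} A b) = h b"
    and "lin (\<lambda>(x, y). h x * eps y) (Del A {} b) = h b"
proof -
  have "lin h (lext (\<lambda>(x, y). (\<lambda>z. eps x * ind y z)) (Del {} A b)) =
      lin (\<lambda>(x, y). eps x * h y) (Del {} A b)"
    by (rule lin_lext_isvec[OF Del_isvec])
      (use assms in \<open>auto simp: lin_scaled_ind finite_supp_scaled_ind\<close>)
  moreover have "lext (\<lambda>(x, y). (\<lambda>z. eps x * ind y z)) (Del {} A b) = ind b"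
    by (rule coalgebra_axioms [THEN conjunct2, THEN conjunct2, rule_format, THEN conjunct1]) (use assms in auto)
  ultimately show "lin (\<lambda>(x, y). eps x * h y) (Del {} A b) = h b" by simp
next
  have "lin h (lext (\<lambda>(x, y). (\<lambda>z. ind x z * eps y)) (Del A {} b)) =
      lin (\<lambda>(x, y). h x * eps y) (Del A {} b)"
    by (rule lin_lext_isvec[OF Del_isvec])
      (use assms in \<open>auto simp: lin_scaled_ind finite_supp_scaled_ind mult.commute\<close>)
  moreover have "lext (\<lambda>(x, y). (\<lambda>z. ind x z * eps y)) (Del A {} b) = ind b"
    by (rule coalgebra_axioms [THEN conjunct2, THEN conjunct2, rule_format, THEN conjunct2]) (use assms in auto)
  ultimately show "lin (\<lambda>(x, y). h x * eps y) (Del A {} b) = h b" by simp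
qed

lemma lin_Del_natural:
  assumes fin: "finite A" "finite B" and dis: "A \<inter> B = {}" and b: "b \<in> bas (A \<union> B)"
    and inj: "inj_on \<sigma> (A \<union> B)"
  shows "lin (\<lambda>z. lin (\<lambda>(x, y). h x y) (Del (\<sigma> ` A) (\<sigma> ` B) z)) (act \<sigma> (A \<union> B) b) =
    lin (\<lambda>(x, y). lin (\<lambda>x'. lin (\<lambda>y'. h x' y') (act \<sigma> B y)) (act \<sigma> A x)) (Del A B b)"
proof -
  let ?g = "\<lambda>(x, y). h x y"
  have inj': "inj_on \<sigma> A" "inj_on \<sigma> B" using inj by (auto simp: inj_on_Un)
  have dis': "\<sigma> ` A \<inter> \<sigma> ` B = {}" using dis inj by (auto simp: inj_on_def)
  have "lin ?g (lext (tmap (act \<sigma> A) (act \<sigma> B)) (Del A B b)) =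
      lin (\<lambda>(x, y). lin (\<lambda>x'. lin (\<lambda>y'. h x' y') (act \<sigma> B y)) (act \<sigma> A x)) (Del A B b)"
    by (rule lin_lext_isvec[OF Del_isvec])
      (use fin dis b inj' isvec_finite[OF act_isvec] in \<open>auto simp: tmap_def finite_supp_tens lin_tens\<close>)
  moreover have "lin ?g (Deltav P (\<sigma> ` A) (\<sigma> ` B) (act \<sigma> (A \<union> B) b)) =
      lin (\<lambda>z. lin ?g (Del (\<sigma> ` A) (\<sigma> ` B) z)) (act \<sigma> (A \<union> B) b)"
    unfolding Deltav_def
    by (rule lin_lext_isvec[OF act_isvec])
      (use fin dis' b inj isvec_finite[OF Del_isvec] in \<open>auto simp: image_Un\<close>)
  moreover have "lext (tmap (act \<sigma> A) (act \<sigma> B)) (Del A B b) =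
      Deltav P (\<sigma> ` A) (\<sigma> ` B) (act \<sigma> (A \<union> B) b)"
    by (rule Del_axioms [THEN conjunct2, rule_format]) (use assms in auto)
  ultimately show ?thesis by simp
qed

lemma lin_Del_mul:
  assumes fin: "finite A" "finite B" "finite C" "finite D"
    and dis: "A \<inter> B = {}" "C \<inter> D = {}" "C \<union> D = A \<union> B" and b: "b \<in> bas C" and c: "c \<in> bas D"
  shows "lin (\<lambda>z. lin (\<lambda>(x, y). h x y) (Del A B z)) (mul C D b c) =
    lin (\<lambda>(x1, x2). lin (\<lambda>(y1, y2).
        lin (\<lambda>x. lin (\<lambda>y. h x y) (mul (C \<inter> B) (D \<inter> B) x2 y2)) (mul (C \<inter> A) (D \<inter> A) x1 y1))
      (Del (D \<inter> A) (D \<inter> B) c)) (Del (C \<inter> A) (C \<inter> B) b)"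
proof -
  let ?g = "\<lambda>(x, y). h x y"
  let ?F = "\<lambda>((x1, x2), (y1, y2)). tens (mul (C \<inter> A) (D \<inter> A) x1 y1) (mul (C \<inter> B) (D \<inter> B) x2 y2)"
  have C: "C \<inter> A \<union> C \<inter> B = C" and D: "D \<inter> A \<union> D \<inter> B = D" using dis by auto
  have vb: "isvec (bas (C \<inter> A) \<times> bas (C \<inter> B)) (Del (C \<inter> A) (C \<inter> B) b)"
    by (rule Del_isvec) (use fin dis b C in auto)
  have vc: "isvec (bas (D \<inter> A) \<times> bas (D \<inter> B)) (Del (D \<inter> A) (D \<inter> B) c)"
    by (rule Del_isvec) (use fin dis c D in auto)
  have finmul: "finite (supp (mul (C \<inter> S) (D \<inter> S) x y))" if "x \<in> bas (C \<inter> S)" "y \<in> bas (D \<inter> S)" for S x y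
    by (rule isvec_finite[OF mul_isvec]) (use fin dis that in auto)
  have "lin ?g (lext ?F (tens (Del (C \<inter> A) (C \<inter> B) b) (Del (D \<inter> A) (D \<inter> B) c))) =
    lin (\<lambda>((x1, x2), (y1, y2)).
        lin (\<lambda>x. lin (\<lambda>y. h x y) (mul (C \<inter> B) (D \<inter> B) x2 y2)) (mul (C \<inter> A) (D \<inter> A) x1 y1))
      (tens (Del (C \<inter> A) (C \<inter> B) b) (Del (D \<inter> A) (D \<inter> B) c))"
    by (rule lin_lext_isvec[OF isvec_tens[OF vb vc]]) (auto simp: finmul finite_supp_tens lin_tens)
  also have "\<dots> = lin (\<lambda>(x1, x2). lin (\<lambda>(y1, y2).
        lin (\<lambda>x. lin (\<lambda>y. h x y) (mul (C \<inter> B) (D \<inter> B) x2 y2)) (mul (C \<inter> A) (D \<inter> A) x1 y1))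
      (Del (D \<inter> A) (D \<inter> B) c)) (Del (C \<inter> A) (C \<inter> B) b)"
    by (simp add: lin_tens isvec_finite[OF vb] isvec_finite[OF vc] case_prod_unfold)
  finally have R: "lin ?g (lext ?F (tens (Del (C \<inter> A) (C \<inter> B) b) (Del (D \<inter> A) (D \<inter> B) c))) = \<dots>" .
  have "lin ?g (Deltav P A B (mul C D b c)) = lin (\<lambda>z. lin ?g (Del A B z)) (mul C D b c)"
    unfolding Deltav_def
    by (rule lin_lext_isvec[OF mul_isvec]) (use assms isvec_finite[OF Del_isvec] in auto)
  moreover have "Deltav P A B (mul C D b c) =
      lext ?F (tens (Del (C \<inter> A) (C \<inter> B) b) (Del (D \<inter> A) (D \<inter> B) c))"
    by (rule bialgebra_axioms [THEN conjunct2, THEN conjunct2, THEN conjunct2, THEN conjunct1, rule_format]) (use assms in auto)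
  ultimately show ?thesis using R by simp
qed

text \<open>On the right, \<open>x\<close> and \<open>y\<close> are the legs of \<delta>(u), and
  \<open>z\<close> and \<open>t\<close> those of \<delta>(v). The left legs \<open>x\<close> and
  \<open>z\<close> stay apart while the right legs are multiplied, as the map m_{1,3,24}
  prescribes.\<close>

lemma lin_Del_del:
  assumes fin: "finite A" "finite B" and dis: "A \<inter> B = {}" and b: "b \<in> bas (A \<union> B)"
  shows "lin (\<lambda>(x, y). lin (\<lambda>(p, q). h p q y) (Del A B x)) (del (A \<union> B) b) =
    lin (\<lambda>(u, v). lin (\<lambda>(x, y). lin (\<lambda>(z, t). lin (\<lambda>w. h x z w) (mul A B y t)) (del B v)) (del A u))
      (Del A B b)"
proof -
  let ?g = "\<lambda>(p, q, r). h p q r"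
  let ?L = "\<lambda>(x, y). (\<lambda>(p, q, r). Del A B x (p, q) * ind y r)"
  let ?F = "\<lambda>((x, y), (z, t)). tens (ind x) (tens (ind z) (mul A B y t))"
  let ?R = "\<lambda>(u, v). lext ?F (tens (del A u) (del B v))"
  have finmul: "finite (supp (mul A B y t))" if "y \<in> bas A" "t \<in> bas B" for y t
    by (rule isvec_finite[OF mul_isvec]) (use assms that in auto)
  have "lin ?g (lext ?L (del (A \<union> B) b)) =
      lin (\<lambda>(x, y). lin (\<lambda>(p, q). h p q y) (Del A B x)) (del (A \<union> B) b)"
    by (rule lin_lext_isvec[OF del_isvec])
      (use assms isvec_finite[OF Del_isvec] in \<open>auto simp: finite_supp_tens_assoc lin_tens_assoc\<close>)
  moreover have "lin ?g (lext ?R (Del A B b)) =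
    lin (\<lambda>(u, v). lin (\<lambda>(x, y). lin (\<lambda>(z, t). lin (\<lambda>w. h x z w) (mul A B y t)) (del B v)) (del A u))
      (Del A B b)"
  proof (rule lin_lext_isvec[OF Del_isvec[OF fin dis b]])
    fix w assume "w \<in> bas A \<times> bas B"
    then obtain u v where w: "w = (u, v)" and u: "u \<in> bas A" and v: "v \<in> bas B" by auto
    have vu: "isvec (bas A \<times> bas A) (del A u)" and vv: "isvec (bas B \<times> bas B) (del B v)"
      using del_isvec fin u v by auto
    have vt: "isvec ((bas A \<times> bas A) \<times> (bas B \<times> bas B)) (tens (del A u) (del B v))"
      by (rule isvec_tens[OF vu vv])
    show "finite (supp (?R w))"
      unfolding w prod.case
      by (rule finite_supp_lext)
        (use vt finmul in \<open>auto simp: isvec_def intro!: finite_supp_tens\<close>)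
    have "lin ?g (lext ?F (tens (del A u) (del B v))) =
      lin (\<lambda>((x, y), (z, t)). lin (\<lambda>w. h x z w) (mul A B y t)) (tens (del A u) (del B v))"
      by (rule lin_lext_isvec[OF vt]) (auto simp: finmul finite_supp_tens lin_tens)
    then show "lin ?g (?R w) = (case w of (u, v) \<Rightarrow>
        lin (\<lambda>(x, y). lin (\<lambda>(z, t). lin (\<lambda>w. h x z w) (mul A B y t)) (del B v)) (del A u))"
      by (simp add: w lin_tens isvec_finite[OF vu] isvec_finite[OF vv] case_prod_unfold)
  qed
  moreover have "lext ?L (del (A \<union> B) b) = lext ?R (Del A B b)"
    by (rule double_axioms [THEN conjunct2, THEN conjunct2, THEN conjunct2, THEN conjunct2, THEN conjunct2, THEN conjunct1, rule_format]) (use assms in auto)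
  ultimately show ?thesis by simp
qed

lemma lin_del_natural:
  assumes fin: "finite A" and b: "b \<in> bas A" and inj: "inj_on \<sigma> A"
  shows "lin (\<lambda>z. lin (\<lambda>(x, y). h x y) (del (\<sigma> ` A) z)) (act \<sigma> A b) =
    lin (\<lambda>(x, y). lin (\<lambda>x'. lin (\<lambda>y'. h x' y') (act \<sigma> A y)) (act \<sigma> A x)) (del A b)"
proof -
  let ?g = "\<lambda>(x, y). h x y"
  have "lin ?g (lext (tmap (act \<sigma> A) (act \<sigma> A)) (del A b)) =
      lin (\<lambda>(x, y). lin (\<lambda>x'. lin (\<lambda>y'. h x' y') (act \<sigma> A y)) (act \<sigma> A x)) (del A b)"
    by (rule lin_lext_isvec[OF del_isvec])
      (use assms isvec_finite[OF act_isvec] in \<open>auto simp: tmap_def finite_supp_tens lin_tens\<close>)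
  moreover have "lin ?g (deltav P (\<sigma> ` A) (act \<sigma> A b)) =
      lin (\<lambda>z. lin ?g (del (\<sigma> ` A) z)) (act \<sigma> A b)"
    unfolding deltav_def
    by (rule lin_lext_isvec[OF act_isvec]) (use assms isvec_finite[OF del_isvec] in auto)
  moreover have "deltav P (\<sigma> ` A) (act \<sigma> A b) = lext (tmap (act \<sigma> A) (act \<sigma> A)) (del A b)"
    by (rule del_axioms [THEN conjunct2, THEN conjunct1, rule_format]) (use assms in auto)
  ultimately show ?thesis by simp
qed

text \<open>Supplies the case of the empty composition in \<open>coef_del\<close>.\<close>

lemma lin_del_eps:
  assumes "b \<in> bas {}"
  shows "lin (\<lambda>(x, y). eps x * h y) (del {} b) = eps b * lin h unit"
proof -
  have "lin h (lext (\<lambda>(x, y). (\<lambda>z. eps x * ind y z)) (del {} b)) =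
      lin (\<lambda>(x, y). eps x * h y) (del {} b)"
    by (rule lin_lext_isvec[OF del_isvec])
      (use assms in \<open>auto simp: lin_scaled_ind finite_supp_scaled_ind\<close>)
  moreover have "lext (\<lambda>(x, y). (\<lambda>z. eps x * ind y z)) (del {} b) = (\<lambda>z. eps b * unit z)"
    by (rule double_axioms [THEN conjunct2, THEN conjunct2, THEN conjunct2, THEN conjunct2, THEN conjunct2, THEN conjunct2, rule_format]) (use assms in auto)
  ultimately show ?thesis by (simp add: lin_smult)
qed

text \<open>The counit \<epsilon>' of \<delta>, set to zero outside the bases so that it satisfies
  \<open>extensional_fam\<close> and can be an element of \<open>Char P\<close>.\<close>

definition eps2 :: "nat set \<Rightarrow> 'b \<Rightarrow> 'k" where
  "eps2 A b = (if finite A \<and> b \<in> bas A then sp_eps2 P A b else 0)"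

lemma lin_del_counit:
  assumes "finite A" "b \<in> bas A"
  shows "lin (\<lambda>(x, y). eps2 A x * h y) (del A b) = h b"
    and "lin (\<lambda>(x, y). h x * eps2 A y) (del A b) = h b"
proof -
  have "lin h (lext (\<lambda>(x, y). (\<lambda>z. sp_eps2 P A x * ind y z)) (del A b)) =
      lin (\<lambda>(x, y). eps2 A x * h y) (del A b)"
    by (rule lin_lext_isvec[OF del_isvec])
      (use assms in \<open>auto simp: eps2_def lin_scaled_ind finite_supp_scaled_ind\<close>)
  moreover have "lext (\<lambda>(x, y). (\<lambda>z. sp_eps2 P A x * ind y z)) (del A b) = ind b"
    by (rule del_axioms [THEN conjunct2, THEN conjunct2, THEN conjunct2, THEN conjunct1]) (use assms in auto)
  ultimately show "lin (\<lambda>(x, y). eps2 A x * h y) (del A b) = h b" by simp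
next
  have "lin h (lext (\<lambda>(x, y). (\<lambda>z. ind x z * sp_eps2 P A y)) (del A b)) =
      lin (\<lambda>(x, y). h x * eps2 A y) (del A b)"
    by (rule lin_lext_isvec[OF del_isvec])
      (use assms in \<open>auto simp: eps2_def lin_scaled_ind finite_supp_scaled_ind mult.commute\<close>)
  moreover have "lext (\<lambda>(x, y). (\<lambda>z. ind x z * sp_eps2 P A y)) (del A b) = ind b"
    by (rule del_axioms [THEN conjunct2, THEN conjunct2, THEN conjunct2, THEN conjunct2]) (use assms in auto)
  ultimately show "lin (\<lambda>(x, y). h x * eps2 A y) (del A b) = h b" by simp
qed

end

section \<open>The morphism to \<open>Comp\<close> induced by a character\<close>

context connected_double_twisted_bialgebra
begin

lemma eps_mul: "b \<in> bas {} \<Longrightarrow> c \<in> bas {} \<Longrightarrow> lin eps (mul {} {} b c) = eps b * eps c"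
  by (rule bialgebra_axioms [THEN conjunct2, THEN conjunct2, THEN conjunct2, THEN conjunct2,
      THEN conjunct2, THEN conjunct1, rule_format])

lemma eps_unit: "lin eps unit = 1"
  by (rule bialgebra_axioms [THEN conjunct2, THEN conjunct2, THEN conjunct2, THEN conjunct2,
      THEN conjunct2, THEN conjunct2])

lemma eps2_mul:
  assumes "finite A" "finite B" "A \<inter> B = {}" "b \<in> bas A" "c \<in> bas B"
  shows "lin (eps2 (A \<union> B)) (mul A B b c) = eps2 A b * eps2 B c"
proof -
  have "lin (eps2 (A \<union> B)) (mul A B b c) = lin (sp_eps2 P (A \<union> B)) (mul A B b c)"
    by (rule lin_cong_isvec[OF mul_isvec]) (use assms in \<open>auto simp: eps2_def\<close>)
  also have "\<dots> = sp_eps2 P A b * sp_eps2 P B c"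
    by (rule double_axioms [THEN conjunct2, THEN conjunct2, THEN conjunct1, rule_format, THEN conjunct2])
      (use assms in auto)
  finally show ?thesis using assms by (simp add: eps2_def)
qed

lemma eps2_unit: "lin (eps2 {}) unit = 1"
proof -
  have "lin (eps2 {}) unit = lin (sp_eps2 P {}) unit"
    by (rule lin_cong_isvec[OF unit_isvec]) (auto simp: eps2_def)
  also have "\<dots> = 1"
    by (rule double_axioms [THEN conjunct2, THEN conjunct2, THEN conjunct2, THEN conjunct2, THEN conjunct1])
  finally show ?thesis .
qed

text \<open>Here connectedness enters: P[\<emptyset>] is a line, and the unit spans it because
  \<open>eps\<close> takes the value 1 there. A functional on P[\<emptyset>] is thus known from its
  value at the unit. In particular every character agrees with \<open>eps\<close> on P[\<emptyset>],
  which makes empty blocks harmless.\<close>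

lemma functional_eq_eps:
  assumes "lin g unit = 1" "b \<in> bas {}"
  shows "g b = eps b"
proof -
  obtain e where e: "bas {} = {e}"
    using connected unfolding connected_def by (meson card_1_singletonE)
  then have "supp unit \<subseteq> {e}" using unit_isvec by (simp add: isvec_def)
  then have lin: "lin h unit = unit e * h e" for h :: "'b \<Rightarrow> 'k"
    using lin_eq_sum[of "{e}" unit h] by simp
  have 1: "unit e * g e = 1" "unit e * eps e = 1"
    using assms(1) eps_unit by (simp_all add: lin)
  then have "unit e \<noteq> 0" by auto
  then have "g e = eps e" using 1 by (metis mult_left_cancel)
  then show ?thesis using assms(2) e by simp
qed

text \<open>A counit is determined by its coproduct, so the naturality of \<open>\<delta>\<close> forces that of
  \<open>\<epsilon>'\<close>, which is not among the axioms.\<close>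

lemma eps2_natural:
  assumes A: "finite A" and b: "b \<in> bas A" and inj: "inj_on \<sigma> A"
  shows "lin (eps2 (\<sigma> ` A)) (act \<sigma> A b) = eps2 A b"
proof -
  define \<tau> where "\<tau> = inv_into A \<sigma>"
  have \<tau>: "\<tau> ` \<sigma> ` A = A" "inj_on \<tau> (\<sigma> ` A)" "\<And>x. x \<in> A \<Longrightarrow> (\<tau> \<circ> \<sigma>) x = x"
    using inj by (auto simp: \<tau>_def inj_on_inv_into image_image)
  \<comment> \<open>Functoriality for \<sigma> followed by its inverse.\<close>
  have cancel: "lin (\<lambda>y. lin g (act \<tau> (\<sigma> ` A) y)) (act \<sigma> A c) = g c" if c: "c \<in> bas A" for c g
  proof -
    have "lin g (act (\<tau> \<circ> \<sigma>) A c) = lin (\<lambda>y. lin g (act \<tau> (\<sigma> ` A) y)) (act \<sigma> A c)"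
      unfolding act_comp[OF A inj \<tau>(2) c]
      by (rule lin_lext_isvec[OF act_isvec[OF A inj c]])
        (use A \<tau>(2) isvec_finite[OF act_isvec] in auto)
    then show ?thesis using act_id[OF A \<tau>(3) c] by simp
  qed
  \<comment> \<open>The usual comparison of two counits, with \<open>?g\<close> the counit of P[A]
    transported along \<sigma>. The product of the counit of P[\<sigma>(A)] with \<open>?g\<close>
    is evaluated on \<delta> of the relabelled \<open>b\<close>: first the left factor is removed by
    the counit axiom, then, after \<sigma> has been moved through \<delta>, the right one.\<close>
  let ?g = "\<lambda>y. lin (eps2 A) (act \<tau> (\<sigma> ` A) y)"
  have "eps2 A b = lin ?g (act \<sigma> A b)" by (rule cancel[OF b, symmetric])
  also have "\<dots> = lin (\<lambda>z. lin (\<lambda>(x, y). eps2 (\<sigma> ` A) x * ?g y) (del (\<sigma> ` A) z)) (act \<sigma> A b)"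
    by (rule lin_cong_isvec[OF act_isvec[OF A inj b]]) (use A in \<open>simp add: lin_del_counit\<close>)
  also have "\<dots> = lin (\<lambda>(x, y). lin (\<lambda>x'. lin (\<lambda>y'. eps2 (\<sigma> ` A) x' * ?g y') (act \<sigma> A y)) (act \<sigma> A x)) (del A b)"
    by (rule lin_del_natural[OF A b inj])
  also have "\<dots> = lin (\<lambda>(x, y). lin (eps2 (\<sigma> ` A)) (act \<sigma> A x) * eps2 A y) (del A b)"
    by (rule lin_del_cong[OF A b]) (simp add: lin_mult_left lin_mult_right cancel)
  also have "\<dots> = lin (eps2 (\<sigma> ` A)) (act \<sigma> A b)"
    by (rule lin_del_counit(2)[OF A b])
  finally show ?thesis by simp
qed

text \<open>\<open>coef f (C\<^sub>1, \<dots>, C\<^sub>k)\<close> is the functional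
  \<open>f\<^sup>\<otimes>\<^sup>k \<circ> \<Delta>\<close> with \<open>\<Delta>\<close> iterated along the blocks.\<close>

primrec coef :: "(nat set \<Rightarrow> 'b \<Rightarrow> 'k) \<Rightarrow> nat set list \<Rightarrow> 'b \<Rightarrow> 'k" where
  "coef f [] = eps"
| "coef f (C # cs) = (\<lambda>b. lin (\<lambda>(u, v). f C u * coef f cs v) (Del C (\<Union> (set cs)) b))"

text \<open>Weaker than being a character: naturality is dropped and products are confined to
  subsets of \<open>U\<close>. This admits families such as
  \<open>\<lambda>S. coef eps2 (restr D S)\<close> for a fixed composition \<open>D\<close> of
  \<open>U\<close>, which need not be natural; \<open>lift_eps2_db_morphism\<close> relies on
  them.\<close>

definition multiplicative_on :: "nat set \<Rightarrow> (nat set \<Rightarrow> 'b \<Rightarrow> 'k) \<Rightarrow> bool" where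
  "multiplicative_on U f \<longleftrightarrow> (\<forall>b\<in>bas {}. f {} b = eps b) \<and>
    (\<forall>A B b c. finite A \<longrightarrow> finite B \<longrightarrow> A \<union> B \<subseteq> U \<longrightarrow> A \<inter> B = {} \<longrightarrow> b \<in> bas A \<longrightarrow> c \<in> bas B \<longrightarrow>
      lin (f (A \<union> B)) (mul A B b c) = f A b * f B c)"

lemma multiplicative_onI:
  assumes "\<And>b. b \<in> bas {} \<Longrightarrow> f {} b = eps b"
    and "\<And>A B b c. finite A \<Longrightarrow> finite B \<Longrightarrow> A \<subseteq> U \<Longrightarrow> B \<subseteq> U \<Longrightarrow> A \<inter> B = {} \<Longrightarrow> b \<in> bas A \<Longrightarrow> c \<in> bas B \<Longrightarrow>
      lin (f (A \<union> B)) (mul A B b c) = f A b * f B c"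
  shows "multiplicative_on U f"
  unfolding multiplicative_on_def using assms by simp

lemma multiplicative_on_empty: "multiplicative_on U f \<Longrightarrow> b \<in> bas {} \<Longrightarrow> f {} b = eps b"
  by (simp add: multiplicative_on_def)

lemma multiplicative_on_mul:
  "multiplicative_on U f \<Longrightarrow> finite A \<Longrightarrow> finite B \<Longrightarrow> A \<union> B \<subseteq> U \<Longrightarrow> A \<inter> B = {} \<Longrightarrow> b \<in> bas A \<Longrightarrow>
    c \<in> bas B \<Longrightarrow> lin (f (A \<union> B)) (mul A B b c) = f A b * f B c"
  by (simp add: multiplicative_on_def)

lemma multiplicative_on_subset: "multiplicative_on U f \<Longrightarrow> V \<subseteq> U \<Longrightarrow> multiplicative_on V f"
  by (rule multiplicative_onI) (auto intro: multiplicative_on_empty multiplicative_on_mul)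

text \<open>\<open>coef\<close> splits off one block at a time; coassociativity allows the iterated
  coproduct to be split at any place instead. This becomes the compatibility of
  \<open>lift f\<close> with deconcatenation.\<close>

lemma coef_append:
  assumes "p @ q \<in> comps A" "finite A" "b \<in> bas A"
  shows "coef f (p @ q) b = lin (\<lambda>(u, v). coef f p u * coef f q v) (Del (\<Union> (set p)) (\<Union> (set q)) b)"
  using assms
proof (induction p arbitrary: A b)
  case Nil
  then show ?case using lin_counit(1)[of A b "coef f q"] by (simp add: comps_Union)
next
  case (Cons C p)
  define S where "S = \<Union> (set p)"
  define T where "T = \<Union> (set q)"
  have pq: "p @ q \<in> comps (A - C)" and C: "C \<subseteq> A"
    using Cons.prems(1) by (simp_all add: comps_Cons_iff)
  have ST: "S \<inter> T = {}" "A - C = S \<union> T" using pq comps_append_iff[of p q] by (simp_all add: S_def T_def)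
  have dis: "C \<inter> S = {}" "C \<inter> T = {}" and A: "A = C \<union> S \<union> T" using ST(2) C by auto
  have fin: "finite C" "finite S" "finite T" using Cons.prems(2) A by auto
  have b: "b \<in> bas (C \<union> S \<union> T)" using Cons.prems(3) A by simp
  have "coef f ((C # p) @ q) b = lin (\<lambda>(u, v). f C u * coef f (p @ q) v) (Del C (S \<union> T) b)"
    by (simp add: S_def T_def)
  also have "\<dots> = lin (\<lambda>(u, v). lin (\<lambda>(v, w). f C u * coef f p v * coef f q w) (Del S T v)) (Del C (S \<union> T) b)"
  proof (rule lin_Del_cong)
    fix u v assume v: "v \<in> bas (S \<union> T)"
    then have "coef f (p @ q) v = lin (\<lambda>(u, v). coef f p u * coef f q v) (Del S T v)"
      using Cons.IH[OF pq, of v] fin ST(2) by (simp add: S_def T_def)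
    then show "f C u * coef f (p @ q) v = lin (\<lambda>(v, w). f C u * coef f p v * coef f q w) (Del S T v)"
      by (simp add: lin_mult_case_left mult.assoc)
  qed (use fin dis b in \<open>auto simp: Un_assoc\<close>)
  also have "\<dots> = lin (\<lambda>(x, z). lin (\<lambda>(u, v). f C u * coef f p v * coef f q z) (Del C S x)) (Del (C \<union> S) T b)"
    by (rule lin_coassoc[symmetric]) (use fin dis ST b in auto)
  finally show ?case by (simp add: lin_mult_case_right S_def T_def)
qed

text \<open>An empty trace contributes the factor \<open>\<epsilon>\<close>, so it may be dropped by \<open>restr\<close>.\<close>

lemma coef_restr_Cons:
  assumes f: "\<And>b. b \<in> bas {} \<Longrightarrow> f {} b = eps b"
    and C: "C # cs \<in> comps U" and S: "finite S" "S \<subseteq> U" and b: "b \<in> bas S"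
  shows "coef f (restr (C # cs) S) b =
    lin (\<lambda>(u, v). f (S \<inter> C) u * coef f (restr cs S) v) (Del (S \<inter> C) (S \<inter> \<Union> (set cs)) b)"
proof (cases "C \<inter> S = {}")
  case True
  then have SC: "S \<inter> C = {}" "S \<inter> \<Union> (set cs) = S" using C S comps_Union[OF C] by auto
  have "lin (\<lambda>(u, v). f {} u * coef f (restr cs S) v) (Del {} S b) =
      lin (\<lambda>(u, v). eps u * coef f (restr cs S) v) (Del {} S b)"
    by (rule lin_Del_cong) (use S b f in auto)
  then show ?thesis using True by (simp add: SC restr_Cons lin_counit(1)[OF S(1) b])
next
  case False
  then show ?thesis by (simp add: restr_Cons Union_restr Int_commute)
qed

text \<open>The coproduct of a product distributes over the traces on the first block
  \<open>C\<close> and on the rest \<open>R\<close>. Multiplicativity of \<open>f\<close> handles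
  the part on \<open>C\<close> and induction the part on \<open>R\<close>. Some traces may be empty,
  which \<open>coef_restr_Cons\<close> absorbs. By \<open>qsh_coeff\<close> this is the
  quasi-shuffle product read on coefficients.\<close>

lemma coef_mul:
  assumes "C \<in> comps (A \<union> B)" "finite A" "finite B" "A \<inter> B = {}" "multiplicative_on (A \<union> B) f"
    "b \<in> bas A" "c \<in> bas B"
  shows "lin (coef f C) (mul A B b c) = coef f (restr C A) b * coef f (restr C B) c"
  using assms
proof (induction C arbitrary: A B b c)
  case Nil
  then show ?case using eps_mul by simp
next
  case (Cons C cs)
  define R where "R = \<Union> (set cs)"
  have cs: "cs \<in> comps R" and CR: "C \<inter> R = {}" "C \<union> R = A \<union> B"
    using Cons.prems(1) comps_append_iff[of "[C]" cs] comps_Union[OF Cons.prems(1)] by (auto simp: R_def)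
  have fin: "finite C" "finite R" using CR(2) Cons.prems(2,3) by (metis finite_Un)+
  note mult = Cons.prems(5) and f = multiplicative_on_empty[OF Cons.prems(5)]
  have multR: "multiplicative_on R f" by (rule multiplicative_on_subset[OF mult]) (use CR in auto)
  have split: "A \<inter> C \<union> A \<inter> R = A" "B \<inter> C \<union> B \<inter> R = B"
    and U: "A \<inter> C \<union> B \<inter> C = C" "A \<inter> R \<union> B \<inter> R = R" using CR by auto
  have restr: "restr cs (A \<inter> R) = restr cs A" "restr cs (B \<inter> R) = restr cs B"
    by (intro restr_cong; auto simp: R_def)+
  have mul: "lin (\<lambda>x. lin (\<lambda>y. f C x * coef f cs y) (mul (A \<inter> R) (B \<inter> R) x2 y2)) (mul (A \<inter> C) (B \<inter> C) x1 y1) =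
      (f (A \<inter> C) x1 * coef f (restr cs A) x2) * (f (B \<inter> C) y1 * coef f (restr cs B) y2)"
    if "x1 \<in> bas (A \<inter> C)" "x2 \<in> bas (A \<inter> R)" "y1 \<in> bas (B \<inter> C)" "y2 \<in> bas (B \<inter> R)" for x1 x2 y1 y2
  proof -
    have "lin (f (A \<inter> C \<union> B \<inter> C)) (mul (A \<inter> C) (B \<inter> C) x1 y1) = f (A \<inter> C) x1 * f (B \<inter> C) y1"
      by (rule multiplicative_on_mul[OF mult]) (use Cons.prems that in auto)
    moreover have "lin (coef f cs) (mul (A \<inter> R) (B \<inter> R) x2 y2) =
        coef f (restr cs (A \<inter> R)) x2 * coef f (restr cs (B \<inter> R)) y2"
      by (rule Cons.IH) (use Cons.prems cs U that multR in auto)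
    ultimately show ?thesis unfolding U restr by (simp add: lin_mult_left lin_mult_right mult_ac)
  qed
  have "lin (coef f (C # cs)) (mul A B b c) =
      lin (\<lambda>z. lin (\<lambda>(x, y). f C x * coef f cs y) (Del C R z)) (mul A B b c)"
    by (simp add: R_def)
  also have "\<dots> = lin (\<lambda>(x1, x2). lin (\<lambda>(y1, y2).
        lin (\<lambda>x. lin (\<lambda>y. f C x * coef f cs y) (mul (A \<inter> R) (B \<inter> R) x2 y2)) (mul (A \<inter> C) (B \<inter> C) x1 y1))
      (Del (B \<inter> C) (B \<inter> R) c)) (Del (A \<inter> C) (A \<inter> R) b)"
    by (rule lin_Del_mul) (use fin CR Cons.prems in auto)
  also have "\<dots> = lin (\<lambda>(x1, x2). lin (\<lambda>(y1, y2).
        (f (A \<inter> C) x1 * coef f (restr cs A) x2) * (f (B \<inter> C) y1 * coef f (restr cs B) y2))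
      (Del (B \<inter> C) (B \<inter> R) c)) (Del (A \<inter> C) (A \<inter> R) b)"
  proof (rule lin_Del_cong)
    fix x1 x2 assume "x1 \<in> bas (A \<inter> C)" "x2 \<in> bas (A \<inter> R)"
    then show "lin (\<lambda>(y1, y2).
        lin (\<lambda>x. lin (\<lambda>y. f C x * coef f cs y) (mul (A \<inter> R) (B \<inter> R) x2 y2)) (mul (A \<inter> C) (B \<inter> C) x1 y1))
      (Del (B \<inter> C) (B \<inter> R) c) = lin (\<lambda>(y1, y2).
        (f (A \<inter> C) x1 * coef f (restr cs A) x2) * (f (B \<inter> C) y1 * coef f (restr cs B) y2))
      (Del (B \<inter> C) (B \<inter> R) c)"
      by (intro lin_Del_cong mul) (use Cons.prems split CR in auto)
  qed (use Cons.prems split CR in auto)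
  also have "\<dots> = lin (\<lambda>(x1, x2). f (A \<inter> C) x1 * coef f (restr cs A) x2) (Del (A \<inter> C) (A \<inter> R) b) *
      lin (\<lambda>(y1, y2). f (B \<inter> C) y1 * coef f (restr cs B) y2) (Del (B \<inter> C) (B \<inter> R) c)"
    unfolding lin_mult_prod by (simp add: case_prod_unfold)
  also have "\<dots> = coef f (restr (C # cs) A) b * coef f (restr (C # cs) B) c"
    using coef_restr_Cons[where f = f, OF f Cons.prems(1,2) Un_upper1 Cons.prems(6)]
      coef_restr_Cons[where f = f, OF f Cons.prems(1,3) Un_upper2 Cons.prems(7)] by (simp add: R_def)
  finally show ?case .
qed

lemma coef_act:
  assumes nat: "\<And>A \<sigma> b. finite A \<Longrightarrow> inj_on \<sigma> A \<Longrightarrow> b \<in> bas A \<Longrightarrow> lin (f (\<sigma> ` A)) (act \<sigma> A b) = f A b"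
  assumes "c \<in> comps A" "finite A" "inj_on \<sigma> A" "b \<in> bas A"
  shows "lin (coef f (map ((`) \<sigma>) c)) (act \<sigma> A b) = coef f c b"
  using assms(2-)
proof (induction c arbitrary: A b)
  case Nil
  then show ?case using act_id[of A \<sigma> b] by simp
next
  case (Cons C cs)
  define R where "R = \<Union> (set cs)"
  have cs: "cs \<in> comps R" and CR: "C \<inter> R = {}" and A: "A = C \<union> R"
    using Cons.prems(1) comps_append_iff[of "[C]" cs A] by (auto simp: R_def)
  have fin: "finite C" "finite R" using A Cons.prems(2) by auto
  have inj: "inj_on \<sigma> (C \<union> R)" "inj_on \<sigma> C" "inj_on \<sigma> R"
    using Cons.prems(3) A by (auto simp: inj_on_Un)
  have b: "b \<in> bas (C \<union> R)" using Cons.prems(4) A by simp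
  have "\<Union> (set (map ((`) \<sigma>) cs)) = \<sigma> ` R" by (auto simp: R_def)
  then have "lin (coef f (map ((`) \<sigma>) (C # cs))) (act \<sigma> A b) =
      lin (\<lambda>z. lin (\<lambda>(x, y). f (\<sigma> ` C) x * coef f (map ((`) \<sigma>) cs) y) (Del (\<sigma> ` C) (\<sigma> ` R) z))
        (act \<sigma> (C \<union> R) b)"
    by (simp add: A)
  also have "\<dots> = lin (\<lambda>(x, y). lin (\<lambda>x'. lin (\<lambda>y'. f (\<sigma> ` C) x' * coef f (map ((`) \<sigma>) cs) y')
      (act \<sigma> R y)) (act \<sigma> C x)) (Del C R b)"
    by (rule lin_Del_natural[OF fin CR b inj(1)])
  also have "\<dots> = lin (\<lambda>(x, y). f C x * coef f cs y) (Del C R b)"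
    by (rule lin_Del_cong[OF fin CR b])
      (use nat fin inj Cons.IH[OF cs] in \<open>simp add: lin_mult_left lin_mult_right\<close>)
  finally show ?case by (simp add: R_def)
qed

text \<open>Both \<open>\<phi> \<leftarrow> f\<close> and the compatibility of \<open>\<phi>\<close> with \<open>\<delta>\<close> are instances of this identity.\<close>

lemma coef_del:
  assumes "c \<in> comps A" "finite A" "multiplicative_on A h" "b \<in> bas A"
  shows "lin (\<lambda>(x, y). coef eps2 c x * h A y) (del A b) = coef h c b"
  using assms
proof (induction c arbitrary: A b)
  case Nil
  then have A: "A = {}" by simp
  \<comment> \<open>The compatibility of \<open>eps\<close> with \<delta> leaves the factor
    \<open>lin (h {}) unit\<close>, which has to be 1.\<close>
  have "lin (h {}) unit = lin eps unit"
    by (rule lin_cong_isvec[OF unit_isvec]) (use multiplicative_on_empty Nil.prems(3) in auto)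
  then show ?case using Nil.prems(4) by (simp add: A lin_del_eps eps_unit)
next
  case (Cons C cs)
  define R where "R = \<Union> (set cs)"
  have cs: "cs \<in> comps R" and CR: "C \<inter> R = {}" and A: "A = C \<union> R"
    using Cons.prems(1) comps_append_iff[of "[C]" cs A] by (auto simp: R_def)
  have fin: "finite C" "finite R" using A Cons.prems(2) by auto
  have b: "b \<in> bas (C \<union> R)" using Cons.prems(4) A by simp
  note mult = Cons.prems(3)
  have "lin (\<lambda>(x, y). coef eps2 (C # cs) x * h A y) (del A b) =
      lin (\<lambda>(x, y). lin (\<lambda>(p, q). eps2 C p * coef eps2 cs q * h A y) (Del C R x)) (del (C \<union> R) b)"
    by (simp add: lin_mult_case_right R_def[symmetric] A)
  also have "\<dots> = lin (\<lambda>(u, v). lin (\<lambda>(x, y). lin (\<lambda>(z, t).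
      lin (\<lambda>w. eps2 C x * coef eps2 cs z * h A w) (mul C R y t)) (del R v)) (del C u)) (Del C R b)"
    by (rule lin_Del_del[OF fin CR b])
  also have "\<dots> = lin (\<lambda>(u, v). h C u * coef h cs v) (Del C R b)"
  \<comment> \<open>Multiplicativity of \<open>h\<close> separates the expression into a factor on
    \<open>C\<close>, evaluated by the counit of \<delta>, and a factor on \<open>R\<close>,
    evaluated by induction.\<close>
  proof (rule lin_Del_cong[OF fin CR b])
    fix u v assume u: "u \<in> bas C" and v: "v \<in> bas R"
    have "lin (\<lambda>(x, y). lin (\<lambda>(z, t).
        lin (\<lambda>w. eps2 C x * coef eps2 cs z * h A w) (mul C R y t)) (del R v)) (del C u) =
      lin (\<lambda>(x, y). lin (\<lambda>(z, t). (eps2 C x * h C y) * (coef eps2 cs z * h R t)) (del R v)) (del C u)"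
    proof (rule lin_del_cong[OF fin(1) u])
      fix x y assume y: "y \<in> bas C"
      show "lin (\<lambda>(z, t). lin (\<lambda>w. eps2 C x * coef eps2 cs z * h A w) (mul C R y t)) (del R v) =
        lin (\<lambda>(z, t). (eps2 C x * h C y) * (coef eps2 cs z * h R t)) (del R v)"
        by (rule lin_del_cong[OF fin(2) v])
          (subst lin_mult_left, use multiplicative_on_mul[OF mult fin] y CR in \<open>simp add: A mult_ac\<close>)
    qed
    also have "\<dots> = lin (\<lambda>(x, y). eps2 C x * h C y) (del C u) *
        lin (\<lambda>(z, t). coef eps2 cs z * h R t) (del R v)"
      unfolding lin_mult_prod by (simp add: case_prod_unfold)
    also have "\<dots> = h C u * coef h cs v"
      using Cons.IH[OF cs fin(2) _ v] multiplicative_on_subset[OF mult] A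
      by (simp add: lin_del_counit(1)[OF fin(1) u])
    finally show "lin (\<lambda>(x, y). lin (\<lambda>(z, t).
        lin (\<lambda>w. eps2 C x * coef eps2 cs z * h A w) (mul C R y t)) (del R v)) (del C u) =
      h C u * coef h cs v" .
  qed
  finally show ?case by (simp add: R_def)
qed

text \<open>Zero values off the bases make the family extensional, so that equality of morphisms is
  equality of functions.\<close>

definition lift :: "(nat set \<Rightarrow> 'b \<Rightarrow> 'k) \<Rightarrow> nat set \<Rightarrow> 'b \<Rightarrow> nat set list \<Rightarrow> 'k" where
  "lift f A b c = (if finite A \<and> b \<in> bas A \<and> c \<in> comps A then coef f c b else 0)"

lemma lift_isvec: "finite A \<Longrightarrow> isvec (comps A) (lift f A b)"
proof -
  assume A: "finite A"
  have "supp (lift f A b) \<subseteq> comps A" by (auto simp: supp_def lift_def split: if_splits)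
  then show ?thesis unfolding isvec_def using finite_subset finite_comps[OF A] by blast
qed

lemma Char_natural:
  "f \<in> Char P \<Longrightarrow> finite A \<Longrightarrow> inj_on \<sigma> A \<Longrightarrow> b \<in> bas A \<Longrightarrow> lin (f (\<sigma> ` A)) (act \<sigma> A b) = f A b"
  by (simp add: Char_def)

lemma Char_empty: "f \<in> Char P \<Longrightarrow> b \<in> bas {} \<Longrightarrow> f {} b = eps b"
  by (rule functional_eq_eps) (simp_all add: Char_def)

lemma Char_multiplicative_on: "f \<in> Char P \<Longrightarrow> multiplicative_on U f"
  by (rule multiplicative_onI) (use Char_empty in \<open>auto simp: Char_def\<close>)

lemma eps2_Char: "eps2 \<in> Char P"
  using eps2_natural eps2_mul eps2_unit
  by (simp add: Char_def extensional_fam_def) (auto simp: eps2_def)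

text \<open>Checked coefficient by coefficient: \<open>coef_act\<close> gives naturality,
  \<open>coef_mul\<close> the product and \<open>coef_append\<close> the coproduct. The unit and
  counit reduce to the value of \<open>coef\<close> at \<open>[]\<close>, which is
  \<open>eps\<close>.\<close>

lemma lift_morphism:
  assumes f: "f \<in> Char P"
  shows "tb_morphism P (Comp :: (nat set list, 'k) twsp) (lift f)"
  unfolding tb_morphism_def bas_Comp
proof (intro conjI allI ballI impI)
  show "extensional_fam P (lift f)"
    by (auto simp: extensional_fam_def lift_def fun_eq_iff)
next
  fix A b assume "finite A" "b \<in> bas A"
  then show "isvec (comps A) (lift f A b)" by (simp add: lift_isvec)
next
  fix A b and \<sigma> :: "nat \<Rightarrow> nat" assume A: "finite A" and b: "b \<in> bas A" and inj: "inj_on \<sigma> A"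
  show "lext (lift f (\<sigma> ` A)) (act \<sigma> A b) = actv Comp \<sigma> A (lift f A b)"
  proof
    fix d
    have L: "lext (lift f (\<sigma> ` A)) (act \<sigma> A b) d =
        lin (\<lambda>x. if d \<in> comps (\<sigma> ` A) then coef f d x else 0) (act \<sigma> A b)"
      unfolding lext_def by (rule lin_cong_isvec[OF act_isvec[OF A inj b]]) (use A in \<open>simp add: lift_def\<close>)
    show "lext (lift f (\<sigma> ` A)) (act \<sigma> A b) d = actv Comp \<sigma> A (lift f A b) d"
    proof (cases "d \<in> comps (\<sigma> ` A)")
      case True
      then obtain c where c: "c \<in> comps A" and d: "d = map ((`) \<sigma>) c"
        unfolding comps_image[OF inj] by auto
      have "lext (lift f (\<sigma> ` A)) (act \<sigma> A b) d = coef f c b"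
        using L True coef_act[OF Char_natural[OF f] c A inj b] by (simp add: d)
      then show ?thesis
        unfolding d actv_Comp_coeff[OF lift_isvec[OF A] inj c] using A b c by (simp add: lift_def)
    next
      case False
      then show ?thesis using L actv_Comp_zero[OF lift_isvec[OF A] inj False]
        by (simp add: lin_def)
    qed
  qed
next
  fix A B b c assume AB: "finite A \<and> finite B \<and> A \<inter> B = {}" and b: "b \<in> bas A" and c: "c \<in> bas B"
  show "lext (lift f (A \<union> B)) (mul A B b c) = mulv Comp A B (tens (lift f A b) (lift f B c))"
  proof
    fix d
    have "lext (lift f (A \<union> B)) (mul A B b c) d =
        lin (\<lambda>x. if d \<in> comps (A \<union> B) then coef f d x else 0) (mul A B b c)"
      unfolding lext_def by (rule lin_cong_isvec[OF mul_isvec]) (use AB b c in \<open>auto simp: lift_def\<close>)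
    also have "\<dots> = (if d \<in> comps (A \<union> B) then coef f (restr d A) b * coef f (restr d B) c else 0)"
      using AB b c coef_mul[OF _ _ _ _ Char_multiplicative_on[OF f]] by (simp add: lin_def)
    also have "\<dots> = mulv Comp A B (tens (lift f A b) (lift f B c)) d"
      using AB b c restr_in_comps[of d "A \<union> B"]
      by (simp add: mulv_Comp_coeff lift_isvec lift_def)
    finally show "lext (lift f (A \<union> B)) (mul A B b c) d = \<dots>" .
  qed
next
  fix A B b assume AB: "finite A \<and> finite B \<and> A \<inter> B = {}" and b: "b \<in> bas (A \<union> B)"
  show "Deltav Comp A B (lift f (A \<union> B) b) = lext (tmap (lift f A) (lift f B)) (Del A B b)"
  proof
    fix pq :: "nat set list \<times> nat set list"
    obtain p q where pq: "pq = (p, q)" by fastforce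
    let ?Q = "p \<in> comps A \<and> q \<in> comps B"
    \<comment> \<open>The deconcatenation coefficient only tests the union of \<open>p\<close>; as
      \<open>A\<close> and \<open>B\<close> are disjoint, this fixes the union of \<open>q\<close>
      as well.\<close>
    have Q: "?Q \<longleftrightarrow> \<Union> (set p) = A \<and> p @ q \<in> comps (A \<union> B)"
    proof
      assume ?Q
      then show "\<Union> (set p) = A \<and> p @ q \<in> comps (A \<union> B)"
        using AB comps_Union[of p A] comps_Union[of q B] by (simp add: comps_append_iff)
    next
      assume r: "\<Union> (set p) = A \<and> p @ q \<in> comps (A \<union> B)"
      then have "A \<inter> \<Union> (set q) = {}" "A \<union> B = A \<union> \<Union> (set q)"
        unfolding comps_append_iff by metis+
      moreover have "Y = Z" if "A \<inter> Y = {}" "A \<inter> Z = {}" "A \<union> Y = A \<union> Z" for Y Z :: "nat set"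
        using that by auto
      ultimately have "\<Union> (set q) = B" using AB by metis
      moreover have "p \<in> comps (\<Union> (set p))" "q \<in> comps (\<Union> (set q))"
        using r unfolding comps_append_iff by metis+
      ultimately show ?Q using r by metis
    qed
    have "lext (tmap (lift f A) (lift f B)) (Del A B b) pq =
        lin (\<lambda>(x, y). if ?Q then coef f p x * coef f q y else 0) (Del A B b)"
      unfolding lext_def
      by (rule lin_cong_isvec[OF Del_isvec]) (use AB b in \<open>auto simp: pq tmap_def tens_def lift_def\<close>)
    also have "\<dots> = (if ?Q then coef f (p @ q) b else 0)"
    proof (cases ?Q)
      case True
      then have "lin (\<lambda>(x, y). coef f p x * coef f q y) (Del A B b) = coef f (p @ q) b"
        using Q coef_append[of p q "A \<union> B" b f] AB b comps_Union[of p A] comps_Union[of q B] by simp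
      then show ?thesis using True by simp
    qed (auto simp: lin_def case_prod_unfold)
    also have "\<dots> = Deltav Comp A B (lift f (A \<union> B) b) pq"
      unfolding pq using Q AB b isvec_finite[OF lift_isvec[of "A \<union> B" f b]]
      by (simp add: Deltav_Comp_coeff lift_def)
    finally show "Deltav Comp A B (lift f (A \<union> B) b) pq = lext (tmap (lift f A) (lift f B)) (Del A B b) pq"
      by simp
  qed
next
  show "lext (lift f {}) unit = sp_unit Comp"
  proof
    fix c
    have "lext (lift f {}) unit c = lin (\<lambda>b. if c \<in> comps {} then coef f c b else 0) unit"
      unfolding lext_def by (rule lin_cong_isvec[OF unit_isvec]) (simp add: lift_def)
    also have "\<dots> = ind [] c"
    proof -
      have "c \<in> comps {} \<longleftrightarrow> c = []" by (cases c) (auto simp: comps_Cons_iff)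
      then show ?thesis by (simp add: eps_unit ind_apply)
    qed
    finally show "lext (lift f {}) unit c = sp_unit Comp c" by simp
  qed
next
  fix b assume b: "b \<in> bas {}"
  have "lin (sp_eps Comp) (lift f {} b) = lin (\<lambda>c. if [] = c then 1 else 0) (lift f {} b)"
    by (simp add: eq_commute)
  also have "\<dots> = eps b"
    using b by (subst lin_if_eq) (simp_all add: isvec_finite[OF lift_isvec] lift_def)
  finally show "lin (sp_eps Comp) (lift f {} b) = eps b" .
qed

text \<open>The counit of \<open>Comp\<close> reads the coefficient at the one-block composition.
  For nonempty \<open>A\<close> it is f \<otimes> \<epsilon> applied to \<Delta>_{A,\<emptyset>},
  hence f by the counit axiom; for empty \<open>A\<close> it is \<open>eps\<close>, which agrees
  with \<open>f\<close> by \<open>Char_empty\<close>.\<close>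

lemma varsigma'_lift:
  assumes f: "f \<in> Char P"
  shows "varsigma' (lift f) = f"
proof (intro ext)
  fix A b
  show "varsigma' (lift f) A b = f A b"
  proof (cases "finite A \<and> b \<in> bas A")
    case True
    then have A: "finite A" and b: "b \<in> bas A" by auto
    have "varsigma' (lift f) A b = coef f (one_block A) b"
      unfolding varsigma'_def eps2_Comp[OF lift_isvec[OF A]]
      using A b one_block_in_comps by (simp add: lift_def)
    also have "\<dots> = f A b"
      using b Char_empty[OF f] lin_counit(2)[OF A b] by (cases "A = {}") (auto simp: one_block_def)
    finally show ?thesis .
  next
    case False
    then have "f A b = 0" "lift f A b = (\<lambda>c. 0)"
      using f by (auto simp: Char_def extensional_fam_def lift_def)
    then show ?thesis by (simp add: varsigma'_def lin_def supp_def)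
  qed
qed

section \<open>Bialgebra morphisms to \<open>Comp\<close> come from characters\<close>

context
  fixes \<psi> :: "nat set \<Rightarrow> 'b \<Rightarrow> nat set list \<Rightarrow> 'k"
  assumes psi: "tb_morphism P (Comp :: (nat set list, 'k) twsp) \<psi>"
begin

lemmas psi_axioms = psi [unfolded tb_morphism_def bas_Comp]

lemma psi_isvec: "finite A \<Longrightarrow> b \<in> bas A \<Longrightarrow> isvec (comps A) (\<psi> A b)"
  by (rule psi_axioms [THEN conjunct2, THEN conjunct1, rule_format, THEN conjunct1])

lemma psi_extensional: "\<not> (finite A \<and> b \<in> bas A) \<Longrightarrow> \<psi> A b = 0"
  by (rule psi_axioms [THEN conjunct1, unfolded extensional_fam_def, rule_format])

lemma varsigma'_psi: "finite A \<Longrightarrow> b \<in> bas A \<Longrightarrow> varsigma' \<psi> A b = \<psi> A b (one_block A)"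
  unfolding varsigma'_def by (rule eps2_Comp[OF psi_isvec])

lemma lin_varsigma'_psi:
  assumes "finite A" "isvec (bas A) v"
  shows "lin (varsigma' \<psi> A) v = lext (\<psi> A) v (one_block A)"
  unfolding lext_def by (rule lin_cong_isvec[OF assms(2)]) (simp add: varsigma'_psi assms(1))

text \<open>Relabelling and restriction turn one-block compositions into one-block compositions.
  Reading the coefficient there converts the axioms of a morphism into those of a character.\<close>

lemma varsigma'_Char: "varsigma' \<psi> \<in> Char P"
  unfolding Char_def mem_Collect_eq
proof (intro conjI allI ballI impI)
  show "extensional_fam P (varsigma' \<psi>)"
    using psi_extensional by (auto simp: extensional_fam_def varsigma'_def lin_def supp_def)
next
  fix A b and \<sigma> :: "nat \<Rightarrow> nat" assume A: "finite A" and b: "b \<in> bas A" and inj: "inj_on \<sigma> A"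
  have ob: "one_block (\<sigma> ` A) = map ((`) \<sigma>) (one_block A)" by (simp add: one_block_def)
  have "lin (varsigma' \<psi> (\<sigma> ` A)) (act \<sigma> A b) = lext (\<psi> (\<sigma> ` A)) (act \<sigma> A b) (one_block (\<sigma> ` A))"
    using A by (intro lin_varsigma'_psi act_isvec inj b) auto
  also have "lext (\<psi> (\<sigma> ` A)) (act \<sigma> A b) = actv Comp \<sigma> A (\<psi> A b)"
    by (rule psi_axioms [THEN conjunct2, THEN conjunct1, rule_format, THEN conjunct2, rule_format])
      (use A b inj in auto)
  also have "\<dots> (one_block (\<sigma> ` A)) = varsigma' \<psi> A b"
    unfolding ob actv_Comp_coeff[OF psi_isvec[OF A b] inj one_block_in_comps]
    by (simp add: varsigma'_psi A b)
  finally show "lin (varsigma' \<psi> (\<sigma> ` A)) (act \<sigma> A b) = varsigma' \<psi> A b" .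
next
  fix A B b c assume AB: "finite A \<and> finite B \<and> A \<inter> B = {}" and b: "b \<in> bas A" and c: "c \<in> bas B"
  have "lin (varsigma' \<psi> (A \<union> B)) (mul A B b c) = lext (\<psi> (A \<union> B)) (mul A B b c) (one_block (A \<union> B))"
    using AB b c by (intro lin_varsigma'_psi mul_isvec) auto
  also have "lext (\<psi> (A \<union> B)) (mul A B b c) = mulv Comp A B (tens (\<psi> A b) (\<psi> B c))"
    by (rule psi_axioms [THEN conjunct2, THEN conjunct2, THEN conjunct1, rule_format, THEN conjunct1, rule_format])
      (use AB b c in auto)
  also have "\<dots> (one_block (A \<union> B)) = varsigma' \<psi> A b * varsigma' \<psi> B c"
    using AB b c by (simp add: mulv_Comp_coeff psi_isvec one_block_in_comps restr_one_block varsigma'_psi)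
  finally show "lin (varsigma' \<psi> (A \<union> B)) (mul A B b c) = varsigma' \<psi> A b * varsigma' \<psi> B c" .
next
  have "lin (varsigma' \<psi> {}) unit = lext (\<psi> {}) unit (one_block {})"
    by (intro lin_varsigma'_psi unit_isvec) simp
  also have "lext (\<psi> {}) unit = sp_unit Comp"
    by (rule psi_axioms [THEN conjunct2, THEN conjunct2, THEN conjunct2, THEN conjunct1])
  finally show "lin (varsigma' \<psi> {}) unit = 1" by (simp add: one_block_def ind_apply)
qed

text \<open>Since \<Delta> on \<open>Comp\<close> is deconcatenation, the coefficient of \<psi>(b)
  at \<open>C # cs\<close> is that of its coproduct at [C] \<otimes> cs. Compatibility of \<psi>
  with \<Delta> then yields the recursion that defines \<open>coef\<close>.\<close>

lemma psi_eq_coef: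
  assumes "c \<in> comps A" "finite A" "b \<in> bas A"
  shows "\<psi> A b c = coef (varsigma' \<psi>) c b"
  using assms
proof (induction c arbitrary: A b)
  case Nil
  then have "A = {}" by simp
  then show ?case using Nil varsigma'_psi[of A b] Char_empty[OF varsigma'_Char, of b]
    by (simp add: one_block_def)
next
  case (Cons C cs)
  define R where "R = \<Union> (set cs)"
  have cs: "cs \<in> comps R" and CR: "C \<inter> R = {}" and A: "A = C \<union> R" and C: "C \<noteq> {}"
    using Cons.prems(1) comps_append_iff[of "[C]" cs A] by (auto simp: R_def comps_Cons_iff)
  have fin: "finite C" "finite R" using A Cons.prems(2) by auto
  have b: "b \<in> bas (C \<union> R)" using Cons.prems(3) A by simp
  have ob: "one_block C = [C]" using C by (simp add: one_block_def)
  have "\<psi> A b (C # cs) = Deltav Comp C R (\<psi> (C \<union> R) b) ([C], cs)"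
    using isvec_finite[OF psi_isvec[OF Cons.prems(2,3)]] by (simp add: A Deltav_Comp_coeff)
  also have "Deltav Comp C R (\<psi> (C \<union> R) b) = lext (tmap (\<psi> C) (\<psi> R)) (Del C R b)"
    by (rule psi_axioms [THEN conjunct2, THEN conjunct2, THEN conjunct1, rule_format, THEN conjunct2, rule_format])
      (use fin CR b in auto)
  also have "\<dots> ([C], cs) = lin (\<lambda>(u, v). varsigma' \<psi> C u * coef (varsigma' \<psi>) cs v) (Del C R b)"
    unfolding lext_def
    by (rule lin_cong_isvec[OF Del_isvec[OF fin CR b]])
      (use fin Cons.IH[OF cs] in \<open>auto simp: tmap_def tens_def varsigma'_psi ob\<close>)
  finally show ?case by (simp add: R_def)
qed

lemma morphism_eq_lift: "\<psi> = lift (varsigma' \<psi>)"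
proof (intro ext)
  fix A b c
  show "\<psi> A b c = lift (varsigma' \<psi>) A b c"
    using psi_eq_coef psi_extensional[of A b] psi_isvec[of A b] isvec_zero[of "comps A" "\<psi> A b" c]
    by (cases "finite A \<and> b \<in> bas A") (auto simp: lift_def)
qed

end

section \<open>Compatibility with the second coproduct\<close>

lemma varsigma_lift:
  assumes f: "f \<in> Char P"
  shows "varsigma P (lift eps2) f = lift f"
proof (intro ext)
  fix A b c
  have "varsigma P (lift eps2) f A b c = lift f A b c" if A: "finite A" and b: "b \<in> bas A"
  proof -
    have "varsigma P (lift eps2) f A b c =
        lin (\<lambda>(x, y). if c \<in> comps A then coef eps2 c x * f A y else 0) (del A b)"
      unfolding varsigma_def lext_def using A b
      by simp (rule lin_cong_isvec[OF del_isvec]; auto simp: lift_def)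
    also have "\<dots> = lift f A b c"
      using coef_del[OF _ A Char_multiplicative_on[OF f] b, of c] A b
      by (cases "c \<in> comps A") (auto simp: lift_def lin_def case_prod_unfold)
    finally show ?thesis .
  qed
  then show "varsigma P (lift eps2) f A b c = lift f A b c"
    by (auto simp: varsigma_def lift_def)
qed

text \<open>Iterating \<Delta> along \<open>C\<close>, and then inside each block along the trace of
  \<open>D\<close>, amounts to iterating it along the Tits product; \<open>coef_append\<close> joins
  the pieces.\<close>

lemma coef_restr_concat:
  assumes "C \<in> comps A" "finite A" "D \<in> comps U" "A \<subseteq> U" "b \<in> bas A"
  shows "coef (\<lambda>S. coef f (restr D S)) C b = coef f (concat (map (restr D) C)) b"
  using assms
proof (induction C arbitrary: A b)
  case (Cons C cs)
  define R where "R = \<Union> (set cs)"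
  have cs: "cs \<in> comps R" and CR: "C \<inter> R = {}" and A: "A = C \<union> R"
    using Cons.prems(1) comps_append_iff[of "[C]" cs A] by (auto simp: R_def)
  have fin: "finite C" "finite R" using A Cons.prems(2) by auto
  have sub: "C \<subseteq> U" "R \<subseteq> U" using A Cons.prems(4) by auto
  have b: "b \<in> bas (C \<union> R)" using Cons.prems(5) A by simp
  let ?p = "restr D C" and ?q = "concat (map (restr D) cs)"
  have p: "\<Union> (set ?p) = C"
    using sub(1) by (intro comps_Union restr_in_comps[OF Cons.prems(3)])
  have q: "\<Union> (set ?q) = R"
    using cs sub(2) by (intro comps_Union concat_restr_in_comps[OF Cons.prems(3)])
  have pq: "?p @ ?q \<in> comps A"
    using concat_restr_in_comps[OF Cons.prems(3,1,4)] by simp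
  have "coef (\<lambda>S. coef f (restr D S)) (C # cs) b = lin (\<lambda>(u, v). coef f ?p u * coef f ?q v) (Del C R b)"
    unfolding coef.simps R_def[symmetric]
    by (rule lin_Del_cong[OF fin CR b]) (simp add: Cons.IH[OF cs fin(2) Cons.prems(3) sub(2)])
  also have "\<dots> = coef f (?p @ ?q) b"
    using coef_append[OF pq Cons.prems(2,5), of f] unfolding p q by simp
  finally show ?case by simp
qed simp

text \<open>At C \<otimes> D the right side is \<open>coef_del\<close> for the family
  \<open>?h\<close>, which gives the iteration of \<open>?h\<close> along \<open>C\<close>. By
  \<open>coef_restr_concat\<close> this is the coefficient at the Tits product, the one that
  \<delta> of \<open>Comp\<close> picks out.\<close>

lemma lift_eps2_db_morphism: "db_morphism P (Comp :: (nat set list, 'k) twsp) (lift eps2)"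
  unfolding db_morphism_def
proof (intro conjI allI impI ballI)
  show "tb_morphism P Comp (lift eps2)" by (rule lift_morphism[OF eps2_Char])
next
  fix A b assume A: "finite A" and b: "b \<in> bas A"
  show "deltav Comp A (lift eps2 A b) = lext (tmap (lift eps2 A) (lift eps2 A)) (del A b)"
  proof
    fix CD :: "nat set list \<times> nat set list"
    obtain C D where CD: "CD = (C, D)" by fastforce
    let ?Q = "C \<in> comps A \<and> D \<in> comps A"
    let ?h = "\<lambda>S. coef eps2 (restr D S)"
    have R: "lext (tmap (lift eps2 A) (lift eps2 A)) (del A b) CD =
        lin (\<lambda>(x, y). if ?Q then coef eps2 C x * coef eps2 D y else 0) (del A b)"
      unfolding lext_def
      by (rule lin_cong_isvec[OF del_isvec[OF A b]]) (use A in \<open>auto simp: CD tmap_def tens_def lift_def\<close>)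
    show "deltav Comp A (lift eps2 A b) CD = lext (tmap (lift eps2 A) (lift eps2 A)) (del A b) CD"
    proof (cases ?Q)
      case True
      then have C: "C \<in> comps A" and D: "D \<in> comps A" by auto
      have mult: "multiplicative_on A ?h"
      proof (rule multiplicative_onI)
        show "?h {} b = eps b" for b by (simp add: restr_def)
        fix S T x y assume *: "finite S" "finite T" "S \<subseteq> A" "T \<subseteq> A" "S \<inter> T = {}" "x \<in> bas S" "y \<in> bas T"
        \<comment> \<open>\<open>coef_mul\<close> asks for a composition of exactly
          \<open>S \<union> T\<close>, so \<open>D\<close> is first cut down to that set;
          \<open>restr_restr\<close> removes the detour afterwards.\<close>
        then have "restr D (S \<union> T) \<in> comps (S \<union> T)" by (intro restr_in_comps[OF D]) auto
        then have "lin (?h (S \<union> T)) (mul S T x y) =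
            coef eps2 (restr (restr D (S \<union> T)) S) x * coef eps2 (restr (restr D (S \<union> T)) T) y"
          using * by (intro coef_mul Char_multiplicative_on eps2_Char)
        moreover have "(S \<union> T) \<inter> S = S" "(S \<union> T) \<inter> T = T" by auto
        ultimately show "lin (?h (S \<union> T)) (mul S T x y) = ?h S x * ?h T y"
          by (simp add: restr_restr)
      qed
      have "lext (tmap (lift eps2 A) (lift eps2 A)) (del A b) CD =
          lin (\<lambda>(x, y). coef eps2 C x * ?h A y) (del A b)"
        using R True restr_id[OF D] by simp
      also have "\<dots> = coef eps2 (concat (map (restr D) C)) b"
        using coef_del[OF C A mult b] coef_restr_concat[OF C A D subset_refl b, of eps2] by simp
      also have "\<dots> = deltav Comp A (lift eps2 A b) CD"
      proof -
        have "concat (map (restr D) C) \<in> comps A"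
          using D C by (rule concat_restr_in_comps) simp
        then show ?thesis using True A b
          by (simp add: CD deltav_Comp_coeff[OF A lift_isvec[OF A]] lift_def)
      qed
      finally show ?thesis by simp
    next
      case False
      then show ?thesis
        using R by (auto simp: CD deltav_Comp_coeff[OF A lift_isvec[OF A]] lin_def case_prod_unfold)
    qed
  qed
  have "lin (sp_eps2 Comp A) (lift eps2 A b) = varsigma' (lift eps2) A b"
    by (simp add: varsigma'_def)
  then show "lin (sp_eps2 Comp A) (lift eps2 A b) = sp_eps2 P A b"
    using A b by (simp add: varsigma'_lift[OF eps2_Char]) (simp add: eps2_def)
qed

text \<open>Compatibility with the counits fixes \<epsilon>' \<circ> \<phi>, and
  \<open>morphism_eq_lift\<close> recovers \<phi> from it.\<close>

lemma db_morphism_unique: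
  assumes "db_morphism P (Comp :: (nat set list, 'k) twsp) \<phi>"
  shows "\<phi> = lift eps2"
proof -
  have tb: "tb_morphism P (Comp :: (nat set list, 'k) twsp) \<phi>"
    and eps: "\<And>A b. finite A \<Longrightarrow> b \<in> bas A \<Longrightarrow> lin (sp_eps2 Comp A) (\<phi> A b) = sp_eps2 P A b"
    using assms unfolding db_morphism_def by simp_all
  have "varsigma' \<phi> = eps2"
  proof (intro ext)
    fix A b
    \<comment> \<open>Off the bases both sides vanish, \<open>eps2\<close> by definition and \<phi>
      by extensionality.\<close>
    show "varsigma' \<phi> A b = eps2 A b"
      using eps[of A b] psi_extensional[OF tb, of A b]
      by (cases "finite A \<and> b \<in> bas A") (auto simp: varsigma'_def eps2_def lin_def supp_def)
  qed
  then show ?thesis using morphism_eq_lift[OF tb] by simp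
qed

end

theorem theorem29:
  fixes P :: "('b, 'k::field) twsp"
  assumes "double_twisted_bialgebra P" and "connected P"
  shows "(\<exists>!\<phi>. db_morphism P (Comp :: (nat set list, 'k) twsp) \<phi>) \<and>
         (\<forall>\<phi>. db_morphism P (Comp :: (nat set list, 'k) twsp) \<phi> \<longrightarrow>
            (\<forall>f\<in>Char P. varsigma P \<phi> f \<in> MorB P (Comp :: (nat set list, 'k) twsp)
                          \<and> varsigma' (varsigma P \<phi> f) = f) \<and>
            (\<forall>\<psi>\<in>MorB P (Comp :: (nat set list, 'k) twsp).
                          varsigma' \<psi> \<in> Char P \<and> varsigma P \<phi> (varsigma' \<psi>) = \<psi>))"
proof -
  interpret connected_double_twisted_bialgebra P
    by unfold_locales (fact assms)+
  show ?thesis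
  proof (intro conjI allI impI ballI)
    show "\<exists>!\<phi>. db_morphism P (Comp :: (nat set list, 'k) twsp) \<phi>"
      using lift_eps2_db_morphism db_morphism_unique by (rule ex1I)
  next
    fix \<phi> f assume "db_morphism P (Comp :: (nat set list, 'k) twsp) \<phi>" and f: "f \<in> Char P"
    \<comment> \<open>Uniqueness replaces the arbitrary \<phi> by \<open>lift eps2\<close>, for
      which \<phi> \<leftarrow> f is \<open>lift f\<close> by \<open>varsigma_lift\<close>.\<close>
    then have \<phi>: "\<phi> = lift eps2" by (simp add: db_morphism_unique)
    show "varsigma P \<phi> f \<in> MorB P Comp" "varsigma' (varsigma P \<phi> f) = f"
      using f by (simp_all add: \<phi> varsigma_lift varsigma'_lift MorB_def lift_morphism)
  next
    fix \<phi> \<psi> assume "db_morphism P (Comp :: (nat set list, 'k) twsp) \<phi>"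
      and "\<psi> \<in> MorB P (Comp :: (nat set list, 'k) twsp)"
    then have \<phi>: "\<phi> = lift eps2" and \<psi>: "tb_morphism P (Comp :: (nat set list, 'k) twsp) \<psi>"
      by (simp_all add: db_morphism_unique MorB_def)
    show "varsigma' \<psi> \<in> Char P" by (rule varsigma'_Char[OF \<psi>])
    then show "varsigma P \<phi> (varsigma' \<psi>) = \<psi>"
      using morphism_eq_lift[OF \<psi>] by (simp add: \<phi> varsigma_lift)
  qed
qed

end
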